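(* Let $\mathbb{K}$ be a field, let $\mathbb{F}_q$ be a finite field of characteristic two and let $\mathcal{C}\subseteq\mathbb{F}_q^n$ be a linear code. Then the universal Gröbner basis of the generalized code ideal $I_+(\mathcal{C})$ associated to $\mathcal{C}$ consists of exactly all those primitive binomials in $I_+(\mathcal{C})$ whose involved terms are both unequal to $1$, with the exception of the binomials of the form $x_{ij}^2-1$ (that is, these binomials are the exception to the requirement that both terms be unequal to $1$).
   Context: Binomials. All binomials are pure: $\mathbf{x}^u-\mathbf{x}^v$ with distinct relatively prime monomials. A binomial $\mathbf{x}^u-\mathbf{x}^v$ in an ideal $I$ is primitive if there is no other binomial $\mathbf{x}^{u'}-\mathbf{x}^{v'}$ in $I$ such that $\mathbf{x}^{u'}$ divides $\mathbf{x}^u$ and $\mathbf{x}^{v'}$ divides $\mathbf{x}^v$. The universal Gröbner basis of $I$ is the union of the reduced Gröbner bases of $I$ over all monomial orders. Generalized code ideal. A linear code is a linear subspace $\mathcal{C}\subseteq\mathbb{F}_q^n$. Fix a primitive element $\alpha$ of $\mathbb{F}_q$. The crossing map $\blacktriangle:\mathbb{F}_q^n\to\mathbb{Z}^{n(q-1)}$ sends $(a_1,\dots,a_n)$ to the concatenation of $n$ blocks of length $q-1$, where the $i$th block is the unit vector $\mathbf{e}_j$ if $a_i=\alpha^j$ with $1\le j\le q-1$, and the zero vector if $a_i=0$. In $\mathbb{K}[\mathbf{x}]=\mathbb{K}[x_{11},\dots,x_{n,q-1}]$ (variables $x_{ij}$, $1\le i\le n$, $1\le j\le q-1$), $I_+(\mathcal{C})=\langle\mathbf{x}^{\blacktriangle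 a}-\mathbf{x}^{\blacktriangle b}\mid a,b\in\mathbb{F}_q^n,\ a-b\in\mathcal{C}\rangle+I_q$, where $I_q$ is the ideal generated by $\bigcup_{i=1}^n\left(\{x_{iu}x_{iv}-x_{iw}\mid\alpha^u+\alpha^v=\alpha^w\}\cup\{x_{iu}x_{iv}-1\mid\alpha^u+\alpha^v=0\}\right)$ with $u,v,w\in\{1,\dots,q-1\}$ ($u=v$ allowed).
   Formalization: The code is additionally assumed to contain no codeword of Hamming weight 1; if it contains one, supported at position i, then x_ij − 1 lies in the universal Gröbner basis, so the claim as printed fails for every such code (e.g. q = 2, n = 1, C = F_2). *)

theory Defs
  imports
    "HOL-Analysis.Analysis"
    "HOL-Library.Poly_Mapping"
    "HOL-Computational_Algebra.Computational_Algebra"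
begin

section \<open>Polynomials, ideals and binomials\<close>

text \<open>
  A monomial \<open>x\<^sup>u\<close> is identified with its exponent vector \<open>u\<close>, so that the product of
  monomials is the sum of exponent vectors and the monomial \<open>1\<close> is \<open>0\<close>. The
  multiplication of \<open>('v, 'k) mpoly\<close> is the convolution product of
  \<^theory>\<open>HOL-Library.Poly_Mapping\<close>.
\<close>

type_synonym 'v monomial = "'v \<Rightarrow>\<^sub>0 nat"
type_synonym ('v, 'k) mpoly = "'v monomial \<Rightarrow>\<^sub>0 'k"

definition mon :: "'v monomial \<Rightarrow> ('v, 'k::comm_ring_1) mpoly" where
  "mon u = Poly_Mapping.single u 1"

definition var :: "'v \<Rightarrow> ('v, 'k::comm_ring_1) mpoly" where
  "var p = mon (Poly_Mapping.single p 1)"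

definition mon_dvd :: "'v monomial \<Rightarrow> 'v monomial \<Rightarrow> bool" where
  "mon_dvd u v \<longleftrightarrow> (\<forall>p. Poly_Mapping.lookup u p \<le> Poly_Mapping.lookup v p)"

text \<open>
  A commutative ring is regarded as a module over itself: \<open>ideal.span B\<close> is the ideal
  generated by \<open>B\<close>.
\<close>

interpretation ideal: module "(*) :: 'a::comm_ring_1 \<Rightarrow> 'a \<Rightarrow> 'a"
  by unfold_locales (simp_all add: algebra_simps)

definition binomial_pair :: "'v monomial \<Rightarrow> 'v monomial \<Rightarrow> bool" where
  "binomial_pair u v \<longleftrightarrow> u \<noteq> v \<and> Poly_Mapping.keys u \<inter> Poly_Mapping.keys v = {}"

definition primitive_binomial ::
  "('v, 'k::comm_ring_1) mpoly set \<Rightarrow> 'v monomial \<Rightarrow> 'v monomial \<Rightarrow> bool" where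
  "primitive_binomial I u v \<longleftrightarrow>
     binomial_pair u v \<and> mon u - mon v \<in> I \<and>
     \<not> (\<exists>u' v'. binomial_pair u' v' \<and> mon u' - mon v' \<in> I \<and> (u', v') \<noteq> (u, v) \<and>
            mon_dvd u' u \<and> mon_dvd v' v)"


section \<open>Groebner bases\<close>

text \<open>
  As there are only finitely many variables, such an order is automatically a
  well-order (Dickson's lemma).
\<close>

definition monomial_order :: "('v::finite) monomial rel \<Rightarrow> bool" where
  "monomial_order r \<longleftrightarrow>
     linear_order r \<and> (\<forall>u. (0, u) \<in> r) \<and> (\<forall>u v w. (u, v) \<in> r \<longrightarrow> (u + w, v + w) \<in> r)"

text \<open>The leading monomial is only meaningful for nonzero polynomials.\<close>

definition lead_mon :: "'v monomial rel \<Rightarrow> ('v, 'k::comm_ring_1) mpoly \<Rightarrow> 'v monomial" where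
  "lead_mon r f = (THE u. u \<in> Poly_Mapping.keys f \<and> (\<forall>v\<in>Poly_Mapping.keys f. (v, u) \<in> r))"

definition initial_ideal ::
  "'v monomial rel \<Rightarrow> ('v, 'k::comm_ring_1) mpoly set \<Rightarrow> ('v, 'k) mpoly set" where
  "initial_ideal r F = ideal.span {mon (lead_mon r f) |f. f \<in> F \<and> f \<noteq> 0}"

definition groebner_basis ::
  "'v monomial rel \<Rightarrow> ('v, 'k::field) mpoly set \<Rightarrow> ('v, 'k) mpoly set \<Rightarrow> bool" where
  "groebner_basis r I G \<longleftrightarrow>
     finite G \<and> G \<subseteq> I \<and> 0 \<notin> G \<and> initial_ideal r G = initial_ideal r I"

definition reduced_groebner_basis ::
  "'v monomial rel \<Rightarrow> ('v, 'k::field) mpoly set \<Rightarrow> ('v, 'k) mpoly set \<Rightarrow> bool" where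
  "reduced_groebner_basis r I G \<longleftrightarrow>
     groebner_basis r I G \<and>
     (\<forall>g\<in>G. Poly_Mapping.lookup g (lead_mon r g) = 1) \<and>
     (\<forall>g\<in>G. \<forall>h\<in>G - {g}. \<forall>u\<in>Poly_Mapping.keys g. \<not> mon_dvd (lead_mon r h) u)"

definition universal_groebner_basis ::
  "('v::finite, 'k::field) mpoly set \<Rightarrow> ('v, 'k) mpoly set" where
  "universal_groebner_basis I =
     \<Union> {G. \<exists>r. monomial_order r \<and> reduced_groebner_basis r I G}"


section \<open>The generalized code ideal\<close>

definition primitive_element :: "'f::{finite,field} \<Rightarrow> bool" where
  "primitive_element \<alpha> \<longleftrightarrow> range (\<lambda>k::nat. \<alpha> ^ k) = UNIV - {0}"

text \<open>
  The index set \<open>{1, \<dots>, q - 1}\<close> as a type, where \<open>q\<close> is the number of elements of \<open>'f\<close>;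
  the variables \<open>x\<^sub>i\<^sub>j\<close> are then indexed by the finite type \<open>'n \<times> 'f expo\<close>.
\<close>

typedef 'f expo = "{1 .. CARD('f::{finite,field}) - 1}"
proof -
  have "card {0, 1 :: 'f} \<le> CARD('f)"
    by (rule card_mono) auto
  then show ?thesis
    by (intro exI[of _ 1]) simp
qed

instance expo :: ("{finite,field}") finite
proof
  have "(UNIV :: 'a expo set) = Abs_expo ` {1 .. CARD('a) - 1}"
    by (rule type_definition.Abs_image[OF type_definition_expo, symmetric])
  then show "finite (UNIV :: 'a expo set)"
    by (metis finite_atLeastAtMost finite_imageI)
qed

definition pw :: "'f::{finite,field} \<Rightarrow> 'f expo \<Rightarrow> 'f" where
  "pw \<alpha> j = \<alpha> ^ Rep_expo j"

text \<open>
  Block \<open>i\<close> of the exponent vector is the unit vector \<open>e\<^sub>j\<close> if \<open>a\<^sub>i = \<alpha>\<^sup>j\<close>; the inner sum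
  has exactly one summand if \<open>a\<^sub>i \<noteq> 0\<close> and is empty if \<open>a\<^sub>i = 0\<close>.
\<close>

definition crossing :: "'f::{finite,field} \<Rightarrow> 'f ^ 'n \<Rightarrow> ('n::finite \<times> 'f expo) monomial" where
  "crossing \<alpha> a = (\<Sum>i\<in>UNIV. \<Sum>j\<in>{j. a $ i = pw \<alpha> j}. Poly_Mapping.single (i, j) 1)"

definition field_ideal ::
  "'f::{finite,field} \<Rightarrow> ('n::finite \<times> 'f expo, 'k::field) mpoly set" where
  "field_ideal \<alpha> = ideal.span (\<Union>i.
     {var (i, u) * var (i, v) - var (i, w) |u v w. pw \<alpha> u + pw \<alpha> v = pw \<alpha> w} \<union>
     {var (i, u) * var (i, v) - 1 |u v. pw \<alpha> u + pw \<alpha> v = 0})"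

definition code_ideal ::
  "'f::{finite,field} \<Rightarrow> ('f ^ 'n) set \<Rightarrow> ('n::finite \<times> 'f expo, 'k::field) mpoly set" where
  "code_ideal \<alpha> C =
     {f + g |f g.
        f \<in> ideal.span {mon (crossing \<alpha> a) - mon (crossing \<alpha> b) |a b. a - b \<in> C} \<and>
        g \<in> field_ideal \<alpha>}"

definition hamming_weight :: "'f::zero ^ 'n \<Rightarrow> nat" where
  "hamming_weight c = card {i. c $ i \<noteq> 0}"

end

theory Submission
  imports Defs
begin

text \<open>
  Every monomial \<open>x\<^sup>u\<close> can be evaluated: \<open>x\<^sub>i\<^sub>j\<close> stands for the vector with \<open>\<alpha>\<^sup>j\<close> in position \<open>i\<close>, and
  products become sums. The relations of the code ideal reduce each monomial to the crossing of
  its value (\<open>monomial_minus_crossing_in_field_ideal\<close>), and all of them preserve the value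
  modulo \<open>C\<close> (\<open>code_ideal_generator\<close>). So \<open>x\<^sup>u - x\<^sup>v\<close> lies in the ideal exactly if \<open>u\<close> and \<open>v\<close> have
  the same value modulo \<open>C\<close>. In characteristic two the group of values modulo \<open>C\<close> has exponent
  two, and the absence of words of weight one says that no variable is congruent to \<open>1\<close>. The
  main argument is about an arbitrary congruence on monomials with these two properties.

  For such a congruence and a monomial order, call a monomial standard if it is the least one of
  its class. The coefficients of a polynomial of the ideal add up to \<open>0\<close> over each class, whence
  the leading monomials of the ideal are the nonstandard ones, and the reduced Groebner basis
  consists of the binomials \<open>x\<^sup>u - x\<^sup>v\<close> with \<open>u\<close> minimal nonstandard and \<open>v\<close> the standard monomial of
  its class (\<open>reduced_groebner_basis_standard_binomials\<close>, \<open>reduced_groebner_basis_subset\<close>).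

  A binomial of this kind is primitive (\<open>standard_binomial_primitive\<close>). If moreover \<open>v\<close> is the
  monomial \<open>1\<close> and \<open>p\<close> is a variable of \<open>u = p u'\<close>, then \<open>u'\<close> is congruent to \<open>p\<close>, because \<open>p\<close> is its own
  inverse; both are proper divisors of \<open>u\<close>, hence standard, hence equal, and \<open>u = p\<^sup>2\<close>
  (\<open>min_nonstandard_eqv_one\<close>).

  Conversely, a primitive binomial with both terms different from \<open>1\<close> has squarefree terms, as the
  squares of variables are congruent to \<open>1\<close>. Since a variable may be moved from one side of a
  congruence to the other, primitivity says that the variable sets \<open>U\<close> and \<open>V\<close> of the two terms
  have as their union a minimal set of variables with product congruent to \<open>1\<close>
  (\<open>primitive_binomial_circuit\<close>). Now let the variables of \<open>U\<close> have weight \<open>|V|\<close>, those of \<open>V\<close> weight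
  \<open>|U|\<close>, and all others a larger weight than \<open>|U| |V|\<close>. For a proper subset \<open>S\<close> of \<open>U\<close>, the only
  squarefree competitor in these variables for being least in the class is the complement of \<open>S\<close>
  in \<open>U \<union> V\<close>, and it is heavier.
  The two terms of the binomial have equal weight, so a tie-break makes the term of \<open>U\<close> leading
  (\<open>circuit_binomial_in_universal_groebner_basis\<close>).
\<close>

section \<open>Monomials\<close>

abbreviation expo_at :: "'v monomial \<Rightarrow> 'v \<Rightarrow> nat" where
  "expo_at \<equiv> Poly_Mapping.lookup"

abbreviation x_mon :: "'v \<Rightarrow> 'v monomial" where
  "x_mon p \<equiv> Poly_Mapping.single p 1"

lemma mon_dvd_iff: "mon_dvd u v \<longleftrightarrow> (\<exists>w. v = u + w)"
proof
  assume "mon_dvd u v"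
  then have "v = u + (v - u)"
    by (intro poly_mapping_eqI) (simp add: mon_dvd_def lookup_add lookup_minus)
  then show "\<exists>w. v = u + w" ..
qed (auto simp: mon_dvd_def lookup_add)

lemma mon_dvd_refl [simp]: "mon_dvd u u"
  by (simp add: mon_dvd_def)

lemma mon_dvd_trans: "mon_dvd u v \<Longrightarrow> mon_dvd v w \<Longrightarrow> mon_dvd u w"
  unfolding mon_dvd_def by (meson order_trans)

lemma mon_dvd_antisym: "mon_dvd u v \<Longrightarrow> mon_dvd v u \<Longrightarrow> u = v"
  unfolding mon_dvd_def by (meson antisym poly_mapping_eqI)

lemma x_mon_dvd_iff: "mon_dvd (x_mon p) u \<longleftrightarrow> p \<in> Poly_Mapping.keys u"
  by (auto simp: mon_dvd_def lookup_single when_def in_keys_iff Suc_le_eq)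

lemma monomial_induct [case_names zero mult]:
  fixes u :: "('v::finite) monomial"
  assumes "P 0" and "\<And>u p. P u \<Longrightarrow> P (u + x_mon p)"
  shows "P u"
proof (induction "\<Sum>p\<in>UNIV. expo_at u p" arbitrary: u rule: less_induct)
  case less
  show ?case
  proof (cases "u = 0")
    case False
    then obtain p where "p \<in> Poly_Mapping.keys u" by fastforce
    then obtain w where w: "u = w + x_mon p"
      by (metis x_mon_dvd_iff mon_dvd_iff add.commute)
    have "P w"
      by (rule less) (simp add: w lookup_add sum.distrib lookup_single when_def)
    then show ?thesis
      unfolding w by (rule assms(2))
  qed (simp add: assms(1))
qed

lemma mon_eq_iff [simp]: "(mon u :: ('v, 'k::field) mpoly) = mon v \<longleftrightarrow> u = v"
proof
  assume "(mon u :: ('v, 'k) mpoly) = mon v"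
  then have "Poly_Mapping.keys (mon u :: ('v, 'k) mpoly) = Poly_Mapping.keys (mon v :: ('v, 'k) mpoly)"
    by simp
  then show "u = v" by (simp add: mon_def)
qed simp

lemma mon_zero: "mon 0 = (1 :: ('v, 'k::field) mpoly)"
  by (simp add: mon_def)

lemma mon_eq_one_iff [simp]: "(mon u :: ('v, 'k::field) mpoly) = 1 \<longleftrightarrow> u = 0"
  using mon_eq_iff[of u 0] by (simp add: mon_zero)

lemma mon_add: "(mon (u + v) :: ('v, 'k::field) mpoly) = mon u * mon v"
  by (simp add: mon_def mult_single)

lemma lookup_mon: "Poly_Mapping.lookup (mon u :: ('v, 'k::field) mpoly) w = (if u = w then 1 else 0)"
  by (simp add: mon_def lookup_single when_def)

lemma keys_mon_diff:
  "u \<noteq> v \<Longrightarrow> Poly_Mapping.keys (mon u - mon v :: ('v, 'k::field) mpoly) = {u, v}"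
  by (auto simp: in_keys_iff lookup_minus lookup_mon split: if_splits)

lemma finite_bounded_monomials: "finite {u :: ('v::finite) monomial. \<forall>p. expo_at u p \<le> b}"
proof (rule finite_imageD)
  have "expo_at ` {u :: 'v monomial. \<forall>p. expo_at u p \<le> b} \<subseteq> Pi\<^sub>E UNIV (\<lambda>_. {..b})"
    by auto
  then show "finite (expo_at ` {u :: 'v monomial. \<forall>p. expo_at u p \<le> b})"
    by (rule finite_subset) (simp add: finite_PiE)
  show "inj_on expo_at {u :: 'v monomial. \<forall>p. expo_at u p \<le> b}"
    by (simp add: inj_on_def)
qed

definition sqfree :: "('v::finite) set \<Rightarrow> 'v monomial" where
  "sqfree S = (\<Sum>p\<in>S. x_mon p)"

lemma expo_at_sqfree: "expo_at (sqfree S) p = (if p \<in> S then 1 else 0)"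
  by (simp add: sqfree_def lookup_sum lookup_single when_def)

lemma keys_sqfree [simp]: "Poly_Mapping.keys (sqfree S) = S"
  by (auto simp: in_keys_iff expo_at_sqfree split: if_splits)

lemma sqfree_eq_iff [simp]: "sqfree S = sqfree T \<longleftrightarrow> S = T"
  using keys_sqfree by metis

lemma sqfree_empty [simp]: "sqfree {} = 0"
  by (simp add: sqfree_def)

lemma sqfree_dvd_iff [simp]: "mon_dvd (sqfree S) (sqfree T) \<longleftrightarrow> S \<subseteq> T"
  by (auto simp: mon_dvd_def expo_at_sqfree split: if_splits)

text \<open>
  Multiplying squarefree monomials is symmetric difference up to a square; in a group of exponent
  two the square disappears.
\<close>
lemma sqfree_add: "sqfree S + sqfree T = sqfree (sym_diff S T) + (sqfree (S \<inter> T) + sqfree (S \<inter> T))"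
  by (rule poly_mapping_eqI) (simp add: lookup_add expo_at_sqfree)

lemma eq_sqfree_keys:
  assumes "\<And>p. expo_at u p \<le> 1"
  shows "u = sqfree (Poly_Mapping.keys u)"
proof (rule poly_mapping_eqI)
  fix p
  show "expo_at u p = expo_at (sqfree (Poly_Mapping.keys u)) p"
    using assms[of p] by (auto simp: expo_at_sqfree in_keys_iff)
qed

lemma dvd_sqfreeE:
  assumes "mon_dvd u (sqfree T)"
  obtains S where "S \<subseteq> T" "u = sqfree S"
proof
  have le: "expo_at u p \<le> (if p \<in> T then 1 else 0)" for p
    using assms by (simp add: mon_dvd_def expo_at_sqfree)
  then show "Poly_Mapping.keys u \<subseteq> T"
    by (metis in_keys_iff le_zero_eq subsetI)
  show "u = sqfree (Poly_Mapping.keys u)"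
    using le by (intro eq_sqfree_keys) (metis le_zero_eq nle_le zero_le_one)
qed

lemma odd_part_decomp:
  obtains h where "u = sqfree {p. odd (expo_at u p)} + (h + h)"
proof
  define h where "h = Poly_Mapping.map (\<lambda>n. n div 2) u"
  have "expo_at h p = expo_at u p div 2" for p
    by (simp add: h_def map.rep_eq when_def)
  then show "u = sqfree {p. odd (expo_at u p)} + (h + h)"
    by (intro poly_mapping_eqI) (simp add: lookup_add expo_at_sqfree, presburger)
qed


section \<open>Monomial orders\<close>

lemma
  assumes "monomial_order r"
  shows monomial_order_refl: "(u, u) \<in> r"
    and monomial_order_trans: "(u, v) \<in> r \<Longrightarrow> (v, w) \<in> r \<Longrightarrow> (u, w) \<in> r"
    and monomial_order_antisym: "(u, v) \<in> r \<Longrightarrow> (v, u) \<in> r \<Longrightarrow> u = v"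
    and monomial_order_total: "(u, v) \<in> r \<or> (v, u) \<in> r"
    and monomial_order_zero: "(0, u) \<in> r"
    and monomial_order_add: "(u, v) \<in> r \<Longrightarrow> (u + w, v + w) \<in> r"
proof -
  have r: "linear_order r"
    using assms by (simp add: monomial_order_def)
  then have props: "refl r" "trans r" "antisym r" "total r"
    by (simp_all add: linear_order_on_def partial_order_on_def preorder_on_def)
  show "(u, u) \<in> r" using props(1) by (simp add: refl_on_def)
  show "(u, v) \<in> r \<or> (v, u) \<in> r"
    using props(1,4) by (cases "u = v") (auto simp: total_on_def refl_on_def)
  show "(u, v) \<in> r \<Longrightarrow> (v, w) \<in> r \<Longrightarrow> (u, w) \<in> r" using props(2) by (rule transD)
  show "(u, v) \<in> r \<Longrightarrow> (v, u) \<in> r \<Longrightarrow> u = v" using props(3) by (rule antisymD)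
  show "(0, u) \<in> r" "(u, v) \<in> r \<Longrightarrow> (u + w, v + w) \<in> r"
    using assms by (auto simp: monomial_order_def)
qed

lemma monomial_orderI:
  assumes "\<And>u v. (u, v) \<in> r \<or> (v, u) \<in> r"
    and "\<And>u v w. (u, v) \<in> r \<Longrightarrow> (v, w) \<in> r \<Longrightarrow> (u, w) \<in> r"
    and "\<And>u v. (u, v) \<in> r \<Longrightarrow> (v, u) \<in> r \<Longrightarrow> u = v"
    and "\<And>u. (0, u) \<in> r"
    and "\<And>u v w. (u, v) \<in> r \<Longrightarrow> (u + w, v + w) \<in> r"
  shows "monomial_order r"
proof -
  have "refl r" using assms(1) unfolding refl_on_def by blast
  moreover have "trans r" using assms(2) by (rule transI)
  moreover have "antisym r" using assms(3) by (rule antisymI)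
  moreover have "total r" using assms(1) unfolding total_on_def by blast
  ultimately show ?thesis
    using assms(4,5) unfolding monomial_order_def
    by (auto simp: linear_order_on_def partial_order_on_def preorder_on_def)
qed

lemma monomial_order_dvd:
  assumes "monomial_order r" "mon_dvd u v"
  shows "(u, v) \<in> r"
proof -
  obtain w where "v = u + w"
    using assms(2) by (auto simp: mon_dvd_iff)
  then show ?thesis
    using monomial_order_add[OF assms(1) monomial_order_zero[OF assms(1), of w], of u]
    by (simp add: add.commute)
qed

lemma monomial_order_finite_min:
  assumes "monomial_order r" "finite A" "A \<noteq> {}"
  obtains a where "a \<in> A" "\<And>b. b \<in> A \<Longrightarrow> (a, b) \<in> r"
proof -
  have "\<exists>a\<in>A. \<forall>b\<in>A. (a, b) \<in> r"
    using assms(2,3)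
  proof (induction rule: finite_ne_induct)
    case (singleton x)
    then show ?case using monomial_order_refl[OF assms(1)] by simp
  next
    case (insert x F)
    then obtain a where a: "a \<in> F" "\<forall>b\<in>F. (a, b) \<in> r" by blast
    then show ?case
      using monomial_order_total[OF assms(1), of x a] monomial_order_trans[OF assms(1), of x a]
        monomial_order_refl[OF assms(1), of x]
      by blast
  qed
  then show thesis using that by blast
qed

lemma monomial_order_finite_max:
  assumes "monomial_order r" "finite A" "A \<noteq> {}"
  obtains a where "a \<in> A" "\<And>b. b \<in> A \<Longrightarrow> (b, a) \<in> r"
proof -
  have "\<exists>a\<in>A. \<forall>b\<in>A. (b, a) \<in> r"
    using assms(2,3)
  proof (induction rule: finite_ne_induct)
    case (singleton x)
    then show ?case using monomial_order_refl[OF assms(1)] by simp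
  next
    case (insert x F)
    then obtain a where a: "a \<in> F" "\<forall>b\<in>F. (b, a) \<in> r" by blast
    then show ?case
      using monomial_order_total[OF assms(1), of x a] monomial_order_trans[OF assms(1), of _ a x]
        monomial_order_refl[OF assms(1), of x]
      by blast
  qed
  then show thesis using that by blast
qed

text \<open>
  Substituting distinct primes for the variables embeds the monomials multiplicatively into the
  positive integers, by unique factorization; the usual order of the integers pulls back.
\<close>
lemma monomial_order_exists: "\<exists>r :: ('v::finite) monomial rel. monomial_order r"
proof -
  have "infinite {p :: nat. prime p}"
    by (rule primes_infinite)
  then obtain P :: "nat set" where P: "finite P" "card P = CARD('v)" "P \<subseteq> {p. prime p}"
    using infinite_arbitrarily_large by blast
  then obtain \<pi> :: "'v \<Rightarrow> nat" where "bij_betw \<pi> UNIV P"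
    using finite_same_card_bij[of "UNIV :: 'v set" P] by auto
  with P(3) have inj: "inj \<pi>" and "range \<pi> \<subseteq> {p. prime p}"
    by (auto simp: bij_betw_def)
  then have prime: "prime (\<pi> p)" for p by blast
  define N :: "'v monomial \<Rightarrow> nat" where "N u = (\<Prod>p\<in>UNIV. \<pi> p ^ expo_at u p)" for u
  have add: "N (u + v) = N u * N v" for u v
    by (simp add: N_def lookup_add power_add prod.distrib)
  have pos: "N u > 0" for u
    using prime by (auto simp: N_def intro!: prod_pos dest: prime_gt_0_nat)
  have mult: "multiplicity (\<pi> p) (N u) = expo_at u p" for p u
  proof -
    have N: "N u = (\<Prod>x\<in>range \<pi>. x ^ expo_at u (inv \<pi> x))"
      using inj by (simp add: N_def prod.reindex)
    then show ?thesis
      using prime inj by (subst N, subst multiplicity_prod_prime_powers) auto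
  qed
  have "u = v" if "N u = N v" for u v
    using mult[of _ u] mult[of _ v] that by (intro poly_mapping_eqI) simp
  then have "monomial_order {(u, v). N u \<le> N v}"
    using pos by (intro monomial_orderI) (auto simp: add N_def[of 0] Suc_le_eq)
  then show ?thesis ..
qed

definition weight :: "('v::finite \<Rightarrow> nat) \<Rightarrow> 'v monomial \<Rightarrow> nat" where
  "weight c u = (\<Sum>p\<in>UNIV. c p * expo_at u p)"

lemma weight_add: "weight c (u + v) = weight c u + weight c v"
  by (simp add: weight_def lookup_add algebra_simps sum.distrib)

lemma weight_zero [simp]: "weight c 0 = 0"
  by (simp add: weight_def)

lemma weight_sqfree: "weight c (sqfree S) = sum c S"
  by (simp add: weight_def expo_at_sqfree if_distrib sum.If_cases cong: if_cong)

lemma weight_x_mon [simp]: "weight c (x_mon p) = c p"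
  using weight_sqfree[of c "{p}"] by (simp add: sqfree_def)

text \<open>
  The refinement of a weight by a given order; nested refinements break ties step by step.
\<close>
definition weighted_order :: "('v::finite \<Rightarrow> nat) \<Rightarrow> 'v monomial rel \<Rightarrow> 'v monomial rel" where
  "weighted_order c r =
     {(u, v). weight c u < weight c v \<or> weight c u = weight c v \<and> (u, v) \<in> r}"

lemma monomial_order_weighted_order:
  assumes "monomial_order r"
  shows "monomial_order (weighted_order c r)"
proof (rule monomial_orderI)
  note r = monomial_order_total[OF assms] monomial_order_trans[OF assms]
    monomial_order_antisym[OF assms] monomial_order_zero[OF assms] monomial_order_add[OF assms]
  fix u v w
  show "(u, v) \<in> weighted_order c r \<or> (v, u) \<in> weighted_order c r"
    using r(1)[of u v] by (auto simp: weighted_order_def)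
  show "(u, w) \<in> weighted_order c r"
    if "(u, v) \<in> weighted_order c r" "(v, w) \<in> weighted_order c r"
    using that by (auto simp: weighted_order_def intro: r(2))
  show "u = v" if "(u, v) \<in> weighted_order c r" "(v, u) \<in> weighted_order c r"
    using that by (auto simp: weighted_order_def intro: r(3))
  show "(0, u) \<in> weighted_order c r"
    by (auto simp: weighted_order_def r(4))
  show "(u + w, v + w) \<in> weighted_order c r" if "(u, v) \<in> weighted_order c r"
    using that by (auto simp: weighted_order_def weight_add intro: r(5))
qed


section \<open>Leading monomials and monomial ideals\<close>

lemma lead_monI:
  assumes "monomial_order r" "u \<in> Poly_Mapping.keys f" "\<And>v. v \<in> Poly_Mapping.keys f \<Longrightarrow> (v, u) \<in> r"
  shows "lead_mon r f = u"
  unfolding lead_mon_def using assms monomial_order_antisym[OF assms(1)]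
  by (intro the_equality) blast+

lemma
  assumes "monomial_order r" "f \<noteq> 0"
  shows lead_mon_in_keys: "lead_mon r f \<in> Poly_Mapping.keys f"
    and lead_mon_max: "v \<in> Poly_Mapping.keys f \<Longrightarrow> (v, lead_mon r f) \<in> r"
proof -
  obtain u where u: "u \<in> Poly_Mapping.keys f" "\<And>v. v \<in> Poly_Mapping.keys f \<Longrightarrow> (v, u) \<in> r"
    using monomial_order_finite_max[OF assms(1), of "Poly_Mapping.keys f"] assms(2) by auto
  then have "lead_mon r f = u"
    by (rule lead_monI[OF assms(1)])
  with u show "lead_mon r f \<in> Poly_Mapping.keys f"
    and "v \<in> Poly_Mapping.keys f \<Longrightarrow> (v, lead_mon r f) \<in> r" by auto
qed

lemma lead_mon_binomial:
  assumes "monomial_order r" "(v, u) \<in> r" "u \<noteq> v"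
  shows "lead_mon r (mon u - mon v :: ('v::finite, 'k::field) mpoly) = u"
  using assms monomial_order_refl[OF assms(1)]
  by (intro lead_monI) (auto simp: keys_mon_diff)

text \<open>
  Multiplication by a polynomial sends a monomial to monomials that it divides, so the
  polynomials all of whose monomials are divisible by an element of \<open>S\<close> form an ideal.
\<close>
lemma mon_in_monomial_ideal_iff:
  "(mon u :: ('v, 'k::field) mpoly) \<in> ideal.span (mon ` S) \<longleftrightarrow> (\<exists>s\<in>S. mon_dvd s u)"
proof
  have "\<forall>m\<in>Poly_Mapping.keys f. \<exists>s\<in>S. mon_dvd s m" if "f \<in> ideal.span (mon ` S)"
    for f :: "('v, 'k) mpoly"
    using that
  proof (induction rule: ideal.span_induct_alt)
    case (step c g f)
    then obtain s where s: "s \<in> S" "g = mon s" by auto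
    have "\<exists>w. m = w + s" if "m \<in> Poly_Mapping.keys (c * g)" for m
      using that keys_mult[of c g] unfolding s mon_def by (auto split: if_splits)
    then show ?case
      using step.IH s(1) Poly_Mapping.keys_add[of "c * g" f]
      by (fastforce simp: mon_dvd_iff add.commute)
  qed simp
  from this[of "mon u"] show "mon u \<in> ideal.span (mon ` S :: ('v, 'k) mpoly set) \<Longrightarrow> \<exists>s\<in>S. mon_dvd s u"
    by (simp add: mon_def)
next
  assume "\<exists>s\<in>S. mon_dvd s u"
  then obtain s w where "s \<in> S" "u = w + s"
    by (auto simp: mon_dvd_iff add.commute)
  then show "(mon u :: ('v, 'k) mpoly) \<in> ideal.span (mon ` S)"
    by (simp add: mon_add ideal.span_scale ideal.span_base)
qed

lemma mon_in_initial_ideal_iff: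
  fixes F :: "('v, 'k::field) mpoly set"
  shows "mon u \<in> initial_ideal r F \<longleftrightarrow> (\<exists>f\<in>F. f \<noteq> 0 \<and> mon_dvd (lead_mon r f) u)"
proof -
  have "{mon (lead_mon r f) |f. f \<in> F \<and> f \<noteq> 0} = (mon ` lead_mon r ` (F - {0}) :: ('v, 'k) mpoly set)"
    by auto
  then show ?thesis
    by (auto simp: initial_ideal_def mon_in_monomial_ideal_iff)
qed

lemma initial_ideal_mono_iff:
  fixes F G :: "('v::finite, 'k::field) mpoly set"
  shows "initial_ideal r F \<subseteq> initial_ideal r G \<longleftrightarrow>
    (\<forall>f\<in>F. f \<noteq> 0 \<longrightarrow> (\<exists>g\<in>G. g \<noteq> 0 \<and> mon_dvd (lead_mon r g) (lead_mon r f)))"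
proof -
  have "initial_ideal r F \<subseteq> initial_ideal r G \<longleftrightarrow>
      {mon (lead_mon r f) |f. f \<in> F \<and> f \<noteq> 0} \<subseteq> initial_ideal r G"
    unfolding initial_ideal_def
    by (intro iffI ideal.span_minimal ideal.subspace_span) (rule order_trans[OF ideal.span_superset])
  also have "\<dots> \<longleftrightarrow> (\<forall>f\<in>F. f \<noteq> 0 \<longrightarrow> mon (lead_mon r f) \<in> initial_ideal r G)"
    by auto
  finally show ?thesis
    by (simp add: mon_in_initial_ideal_iff)
qed


section \<open>Congruences of exponent two\<close>

text \<open>
  The congruence says that two monomials have the same image under a homomorphism to a group of
  exponent two. That the target is a group shows in the cancellation law.
\<close>
locale involutive_congruence =
  fixes eqv :: "('v::finite) monomial \<Rightarrow> 'v monomial \<Rightarrow> bool"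
  assumes equivp: "equivp eqv"
    and eqv_add_iff [simp]: "eqv (u + w) (v + w) \<longleftrightarrow> eqv u v"
    and eqv_double: "eqv (u + u) 0"
begin

lemma eqv_refl [simp]: "eqv u u"
  using equivp by (rule equivp_reflp)

lemma eqv_sym: "eqv u v \<Longrightarrow> eqv v u"
  using equivp by (rule equivp_symp)

lemma eqv_trans: "eqv u v \<Longrightarrow> eqv v w \<Longrightarrow> eqv u w"
  using equivp by (rule equivp_transp)

lemma eqv_add_left_iff [simp]: "eqv (w + u) (w + v) \<longleftrightarrow> eqv u v"
  using eqv_add_iff[of u w v] by (simp add: add.commute)

text \<open>
  Elements of a group of exponent two are equal if and only if their sum vanishes. This is what
  allows variables to change sides in a binomial.
\<close>
lemma eqv_iff_sum: "eqv u v \<longleftrightarrow> eqv (u + v) 0"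
proof -
  have "eqv u v \<longleftrightarrow> eqv (u + v) (v + v)"
    by simp
  also have "\<dots> \<longleftrightarrow> eqv (u + v) 0"
    using eqv_double[of v] eqv_trans eqv_sym by blast
  finally show ?thesis .
qed

lemma eqv_add_double: "eqv (u + (h + h)) u"
  using eqv_add_left_iff[of u "h + h" 0] eqv_double[of h] by simp

lemma eqv_odd_part: "eqv u (sqfree {p. odd (expo_at u p)})"
  using odd_part_decomp[of u] eqv_add_double by metis

lemma odd_part_dvd: "mon_dvd (sqfree {p. odd (expo_at u p)}) u"
  using odd_part_decomp[of u] mon_dvd_iff by metis

lemma eqv_sqfree_iff:
  "eqv (sqfree S) (sqfree T) \<longleftrightarrow> eqv (sqfree (sym_diff S T)) 0"
proof -
  have "eqv (sqfree S) (sqfree T) \<longleftrightarrow>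
      eqv (sqfree (sym_diff S T) + (sqfree (S \<inter> T) + sqfree (S \<inter> T))) 0"
    unfolding eqv_iff_sum[of "sqfree S"] by (subst sqfree_add) (rule refl)
  also have "\<dots> \<longleftrightarrow> eqv (sqfree (sym_diff S T)) 0"
    using eqv_add_double eqv_trans eqv_sym by blast
  finally show ?thesis .
qed

text \<open>
  The classes of the congruence are represented by their least elements. It will turn out that
  the standard monomials are exactly those outside the initial ideal.
\<close>
definition standard :: "'v monomial rel \<Rightarrow> 'v monomial \<Rightarrow> bool" where
  "standard r u \<longleftrightarrow> (\<forall>v. eqv u v \<longrightarrow> (u, v) \<in> r)"

definition min_nonstandard :: "'v monomial rel \<Rightarrow> 'v monomial \<Rightarrow> bool" where
  "min_nonstandard r u \<longleftrightarrow>
     \<not> standard r u \<and> (\<forall>w. mon_dvd w u \<and> w \<noteq> u \<longrightarrow> standard r w)"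

context
  fixes r :: "'v monomial rel"
  assumes r: "monomial_order r"
begin

lemma standard_zero: "standard r 0"
  by (simp add: standard_def monomial_order_zero[OF r])

text \<open>
  Cancellation: if \<open>u\<close> could be replaced by something smaller, so could its multiple \<open>v\<close>.
\<close>
lemma standard_dvd:
  assumes "standard r v" "mon_dvd u v"
  shows "standard r u"
  unfolding standard_def
proof (intro allI impI)
  fix u' assume "eqv u u'"
  obtain w where w: "v = u + w"
    using assms(2) by (auto simp: mon_dvd_iff)
  with \<open>eqv u u'\<close> assms(1) have "(u + w, u' + w) \<in> r"
    by (simp add: standard_def)
  then show "(u, u') \<in> r"
    using monomial_order_total[OF r, of u u'] monomial_order_add[OF r, of u' u w]
      monomial_order_antisym[OF r, of "u + w" "u' + w"] monomial_order_refl[OF r]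
    by (metis add_right_imp_eq)
qed

lemma standard_unique: "standard r u \<Longrightarrow> standard r v \<Longrightarrow> eqv u v \<Longrightarrow> u = v"
  using monomial_order_antisym[OF r] eqv_sym unfolding standard_def by blast

text \<open>
  Removing squares of variables keeps the class and never makes a monomial larger, so only squarefree
  competitors count. As there are finitely many of them, every class has a least element.
\<close>
lemma standardI_sqfree:
  assumes "\<And>T. eqv u (sqfree T) \<Longrightarrow> (u, sqfree T) \<in> r"
  shows "standard r u"
  unfolding standard_def
proof (intro allI impI)
  fix v assume "eqv u v"
  then show "(u, v) \<in> r"
    using assms eqv_trans eqv_odd_part monomial_order_trans[OF r]
      monomial_order_dvd[OF r odd_part_dvd] by blast
qed

lemma ex_standard: "\<exists>v. eqv u v \<and> standard r v"
proof -
  let ?A = "{v \<in> range sqfree. eqv u v}"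
  have "finite ?A" "?A \<noteq> {}"
    using eqv_odd_part[of u] by auto
  then obtain v where v: "v \<in> ?A" "\<And>w. w \<in> ?A \<Longrightarrow> (v, w) \<in> r"
    using monomial_order_finite_min[OF r] by blast
  have "standard r v"
    using v eqv_trans by (intro standardI_sqfree) blast
  with v(1) show ?thesis by auto
qed

lemma min_nonstandard_dvd_eq:
  assumes "min_nonstandard r u" "min_nonstandard r v" "mon_dvd u v"
  shows "u = v"
  using assms unfolding min_nonstandard_def by blast

lemma min_nonstandard_neq_zero: "min_nonstandard r u \<Longrightarrow> u \<noteq> 0"
  using standard_zero by (auto simp: min_nonstandard_def)

lemma not_standard_square: "\<not> standard r (x_mon p + x_mon p)"
proof
  assume "standard r (x_mon p + x_mon p)"
  then have "x_mon p + x_mon p = 0"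
    using standard_unique standard_zero eqv_double by blast
  then have "expo_at (x_mon p + x_mon p) p = 0"
    by simp
  then show False by (simp add: lookup_add)
qed

text \<open>
  Squares of variables are nonstandard, so no exponent of a minimal nonstandard monomial can
  exceed \<open>2\<close>.
\<close>
lemma finite_min_nonstandard: "finite {u. min_nonstandard r u}"
proof (rule finite_subset)
  show "{u. min_nonstandard r u} \<subseteq> {u. \<forall>p. expo_at u p \<le> 2}"
  proof (clarify, rule ccontr)
    fix u p
    assume u: "min_nonstandard r u" and p: "\<not> expo_at u p \<le> 2"
    then have "mon_dvd (x_mon p + x_mon p) u"
      by (auto simp: mon_dvd_def lookup_add lookup_single when_def)
    moreover have "x_mon p + x_mon p \<noteq> u"
      using p by (auto simp: lookup_add)
    ultimately show False
      using u not_standard_square unfolding min_nonstandard_def by blast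
  qed
qed (rule finite_bounded_monomials)

lemma nonstandard_has_min_divisor:
  assumes "\<not> standard r u"
  shows "\<exists>w. min_nonstandard r w \<and> mon_dvd w u"
  using assms
proof (induction "weight (\<lambda>_. 1) u" arbitrary: u rule: less_induct)
  case less
  show ?case
  proof (cases "min_nonstandard r u")
    case False
    then obtain w where w: "mon_dvd w u" "w \<noteq> u" "\<not> standard r w"
      using less.prems by (auto simp: min_nonstandard_def)
    then obtain w' where w': "u = w + w'" "w' \<noteq> 0"
      by (auto simp: mon_dvd_iff)
    then obtain p where "p \<in> Poly_Mapping.keys w'" by fastforce
    then have "weight (\<lambda>_. 1) w' > 0"
      by (auto simp: weight_def in_keys_iff intro: sum_pos2)
    with w' have "weight (\<lambda>_. 1) w < weight (\<lambda>_. 1) u"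
      by (simp add: weight_add)
    from less.hyps[OF this w(3)] show ?thesis
      using w(1) mon_dvd_trans by blast
  qed auto
qed

end

end


section \<open>Coefficient sums over congruence classes\<close>

lemma poly_mapping_eq_sum_single:
  "f = (\<Sum>m\<in>Poly_Mapping.keys f. Poly_Mapping.single m (Poly_Mapping.lookup f m))"
  by (rule poly_mapping_eqI)
    (simp add: lookup_sum lookup_single when_def in_keys_iff if_distrib sum.delta cong: if_cong)

context involutive_congruence
begin

definition coeff_sum :: "'v monomial \<Rightarrow> ('v, 'k::field) mpoly \<Rightarrow> 'k" where
  "coeff_sum u f = (\<Sum>m | m \<in> Poly_Mapping.keys f \<and> eqv m u. Poly_Mapping.lookup f m)"

lemma coeff_sum_superset:
  assumes "finite K" "Poly_Mapping.keys f \<subseteq> K"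
  shows "coeff_sum u f = (\<Sum>m | m \<in> K \<and> eqv m u. Poly_Mapping.lookup f m)"
  unfolding coeff_sum_def using assms
  by (intro sum.mono_neutral_left) (auto simp: in_keys_iff)

lemma coeff_sum_add:
  fixes f g :: "('v, 'k::field) mpoly"
  shows "coeff_sum u (f + g) = coeff_sum u f + coeff_sum u g"
proof -
  let ?K = "Poly_Mapping.keys f \<union> Poly_Mapping.keys g"
  have "coeff_sum u h = (\<Sum>m | m \<in> ?K \<and> eqv m u. Poly_Mapping.lookup h m)"
    if "Poly_Mapping.keys h \<subseteq> ?K" for h :: "('v, 'k) mpoly"
    using that by (intro coeff_sum_superset) auto
  from this[of f] this[of g] this[of "f + g"] show ?thesis
    using Poly_Mapping.keys_add[of f g] by (simp add: lookup_add sum.distrib)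
qed

lemma coeff_sum_zero [simp]: "coeff_sum u 0 = 0"
  by (simp add: coeff_sum_def)

lemma coeff_sum_diff: "coeff_sum u (f - g) = coeff_sum u f - coeff_sum u g"
  using coeff_sum_add[of u "f - g" g] by simp

lemma coeff_sum_sum: "coeff_sum u (sum f A) = (\<Sum>a\<in>A. coeff_sum u (f a))"
  by (induction A rule: infinite_finite_induct) (simp_all add: coeff_sum_add)

lemma coeff_sum_single: "coeff_sum u (Poly_Mapping.single m k) = (if eqv m u then k else 0)"
  by (subst coeff_sum_superset[of "{m}"]) (auto simp: Collect_conv_if)

text \<open>
  The sum of the coefficients over a class is linear and kills every monomial multiple of a
  binomial with congruent terms, since such a multiple again has congruent terms.
\<close>
lemma coeff_sum_span:
  assumes gen: "\<And>g. g \<in> B \<Longrightarrow> \<exists>a b. g = mon a - mon b \<and> eqv a b" and f: "f \<in> ideal.span B"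
  shows "coeff_sum u (f :: ('v, 'k::field) mpoly) = 0"
  using f
proof (induction rule: ideal.span_induct_alt)
  case (step c g f)
  obtain a b where g: "g = mon a - mon b" "eqv a b"
    using gen[OF step(1)] by blast
  have "coeff_sum u (Poly_Mapping.single m k * g) = 0" for m and k :: 'k
  proof -
    have "Poly_Mapping.single m k * g =
        Poly_Mapping.single (m + a) k - Poly_Mapping.single (m + b) k"
      by (simp add: g mon_def mult_single algebra_simps)
    moreover have "eqv (m + a) u \<longleftrightarrow> eqv (m + b) u"
      using g(2) eqv_trans eqv_sym eqv_add_left_iff by metis
    ultimately show ?thesis
      by (simp add: coeff_sum_diff coeff_sum_single)
  qed
  then have "coeff_sum u (c * g) = 0"
    by (subst poly_mapping_eq_sum_single[of c]) (simp add: sum_distrib_right coeff_sum_sum)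
  with step.IH show ?case
    by (simp add: coeff_sum_add)
qed simp

end


section \<open>Reduced Groebner bases of congruence ideals\<close>

text \<open>
  The last two assumptions pin down the ideal: it contains the binomials of the congruence and
  is contained in the kernel of the map to the algebra of the group of classes.
\<close>
locale involutive_congruence_ideal = involutive_congruence eqv
  for eqv :: "('v::finite) monomial \<Rightarrow> 'v monomial \<Rightarrow> bool" +
  fixes I :: "('v, 'k::field) mpoly set"
  assumes var_not_eqv_one: "\<not> eqv (x_mon p) 0"
    and binomial_in: "eqv u v \<Longrightarrow> mon u - mon v \<in> I"
    and class_sum: "f \<in> I \<Longrightarrow>
      (\<Sum>m | m \<in> Poly_Mapping.keys f \<and> eqv m u. Poly_Mapping.lookup f m) = 0"
begin

text \<open>
  The coefficients of a class cannot cancel if there is only one.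
\<close>
lemma no_lonely_term:
  assumes "f \<in> I" "u \<in> Poly_Mapping.keys f"
  obtains v where "v \<in> Poly_Mapping.keys f" "eqv v u" "v \<noteq> u"
proof (rule ccontr)
  assume "\<not> thesis"
  with that assms(2) have "{m. m \<in> Poly_Mapping.keys f \<and> eqv m u} = {u}"
    by auto
  with class_sum[OF assms(1), of u] assms(2) show False
    by (simp add: in_keys_iff)
qed

lemma binomial_in_iff: "mon u - mon v \<in> I \<longleftrightarrow> eqv u v"
proof
  assume in_I: "mon u - mon v \<in> I"
  show "eqv u v"
  proof (cases "u = v")
    case False
    then obtain w where "w \<in> {u, v}" "eqv w u" "w \<noteq> u"
      using no_lonely_term[OF in_I, of u] by (auto simp: keys_mon_diff)
    then show ?thesis by (auto intro: eqv_sym)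
  qed simp
qed (rule binomial_in)

context
  fixes r :: "'v monomial rel"
  assumes r: "monomial_order r"
begin

lemma lead_mon_nonstandard:
  assumes "f \<in> I" "f \<noteq> 0"
  shows "\<not> standard r (lead_mon r f)"
proof
  assume std: "standard r (lead_mon r f)"
  obtain v where v: "v \<in> Poly_Mapping.keys f" "eqv v (lead_mon r f)" "v \<noteq> lead_mon r f"
    using no_lonely_term[OF assms(1) lead_mon_in_keys[OF r assms(2)]] .
  then have "(lead_mon r f, v) \<in> r"
    using std eqv_sym by (simp add: standard_def)
  with v(3) lead_mon_max[OF r assms(2) v(1)] show False
    using monomial_order_antisym[OF r] by blast
qed

lemma lead_mon_standard_binomial:
  assumes "standard r v" "eqv u v" "u \<noteq> v"
  shows "lead_mon r (mon u - mon v :: ('v, 'k) mpoly) = u"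
  using assms eqv_sym by (intro lead_mon_binomial[OF r]) (auto simp: standard_def)

text \<open>
  A nonstandard \<open>u\<close> is the leading monomial of the difference to the standard monomial of its
  class.
\<close>
lemma in_initial_ideal_iff: "mon u \<in> initial_ideal r I \<longleftrightarrow> \<not> standard r u"
proof
  assume "mon u \<in> initial_ideal r I"
  then show "\<not> standard r u"
    using lead_mon_nonstandard standard_dvd[OF r] by (auto simp: mon_in_initial_ideal_iff)
next
  assume u: "\<not> standard r u"
  obtain v where v: "eqv u v" "standard r v"
    using ex_standard[OF r] by blast
  with u have "u \<noteq> v" by auto
  then have "mon u - mon v \<noteq> (0 :: ('v, 'k) mpoly)"
    by simp
  then show "mon u \<in> initial_ideal r I"
    using v binomial_in lead_mon_standard_binomial[OF v(2,1) \<open>u \<noteq> v\<close>]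
    unfolding mon_in_initial_ideal_iff by (metis mon_dvd_refl)
qed

definition standard_binomials :: "('v, 'k) mpoly set" where
  "standard_binomials =
     {mon u - mon v |u v. min_nonstandard r u \<and> standard r v \<and> eqv u v}"

lemma reduced_groebner_basis_standard_binomials:
  "reduced_groebner_basis r I standard_binomials"
proof -
  have neq: "u \<noteq> v" if "min_nonstandard r u" "standard r v" for u v
    using that by (auto simp: min_nonstandard_def)
  have lead: "lead_mon r (mon u - mon v :: ('v, 'k) mpoly) = u"
    if "min_nonstandard r u" "standard r v" "eqv u v" for u v
    using that neq by (intro lead_mon_standard_binomial) auto
  have "standard_binomials \<subseteq>
      (\<lambda>u. mon u - mon (SOME v. eqv u v \<and> standard r v)) ` {u. min_nonstandard r u}"
  proof
    fix g assume "g \<in> standard_binomials"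
    then obtain u v where g: "g = mon u - mon v" "min_nonstandard r u" "standard r v" "eqv u v"
      by (auto simp: standard_binomials_def)
    have "(SOME v. eqv u v \<and> standard r v) = v"
      using g(3,4) by (intro some_equality) (auto intro: standard_unique[OF r] eqv_trans eqv_sym)
    then show "g \<in> (\<lambda>u. mon u - mon (SOME v. eqv u v \<and> standard r v)) ` {u. min_nonstandard r u}"
      using g by auto
  qed
  then have fin: "finite standard_binomials"
    using finite_min_nonstandard[OF r] finite_surj by blast
  have sub: "standard_binomials \<subseteq> I"
    by (auto simp: standard_binomials_def binomial_in)
  have nz: "0 \<notin> standard_binomials"
    using neq by (auto simp: standard_binomials_def)
  have "initial_ideal r standard_binomials \<subseteq> initial_ideal r I"
    unfolding initial_ideal_mono_iff using sub by (auto intro: mon_dvd_refl)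
  moreover have "initial_ideal r I \<subseteq> initial_ideal r standard_binomials"
    unfolding initial_ideal_mono_iff
  proof (intro ballI impI)
    fix f assume "f \<in> I" "f \<noteq> 0"
    then obtain u where u: "min_nonstandard r u" "mon_dvd u (lead_mon r f)"
      using lead_mon_nonstandard nonstandard_has_min_divisor[OF r] by blast
    obtain v where v: "eqv u v" "standard r v"
      using ex_standard[OF r] by blast
    have "mon u - mon v \<in> standard_binomials"
      using u v by (auto simp: standard_binomials_def)
    moreover from this have "mon u - mon v \<noteq> (0 :: ('v, 'k) mpoly)"
      using nz by metis
    ultimately show "\<exists>g\<in>standard_binomials. g \<noteq> 0 \<and> mon_dvd (lead_mon r g) (lead_mon r f)"
      using lead[OF u(1) v(2,1)] u(2) by metis
  qed
  ultimately have gb: "groebner_basis r I standard_binomials"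
    using fin sub nz by (simp add: groebner_basis_def)
  show ?thesis
    unfolding reduced_groebner_basis_def
  proof (intro conjI ballI gb)
    fix g assume "g \<in> standard_binomials"
    then obtain u v where g: "g = mon u - mon v" "min_nonstandard r u" "standard r v" "eqv u v"
      by (auto simp: standard_binomials_def)
    then show "Poly_Mapping.lookup g (lead_mon r g) = 1"
      using lead neq[OF g(2,3)] by (simp add: lookup_minus lookup_mon)
    fix h w assume "h \<in> standard_binomials - {g}" and w: "w \<in> Poly_Mapping.keys g"
    then obtain u' v' where
      h: "h = mon u' - mon v'" "min_nonstandard r u'" "standard r v'" "eqv u' v'" "h \<noteq> g"
      by (auto simp: standard_binomials_def)
    have "u' \<noteq> u"
    proof
      assume "u' = u"
      then have "eqv v v'"
        using g(4) h(4) eqv_sym eqv_trans by blast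
      then have "v = v'"
        using g(3) h(3) by (intro standard_unique[OF r])
      with \<open>u' = u\<close> g(1) h(1,5) show False by simp
    qed
    then have "\<not> mon_dvd u' u"
      using g(2) h(2) min_nonstandard_dvd_eq[OF r] by blast
    moreover have "\<not> mon_dvd u' v"
      using g(3) h(2) standard_dvd[OF r] min_nonstandard_def by blast
    moreover have "w = u \<or> w = v"
      using w g(1) neq[OF g(2,3)] by (auto simp: keys_mon_diff)
    ultimately show "\<not> mon_dvd (lead_mon r h) w"
      using lead[OF h(2,3,4)] h(1) by auto
  qed
qed

text \<open>
  In a reduced Groebner basis all monomials of an element other than its leading one are standard.
  Distinct standard monomials are incongruent, but no class contributes a single term; so
  exactly one term remains to cancel the leading one.
\<close>
lemma reduced_groebner_basis_subset:
  assumes G: "reduced_groebner_basis r I G"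
  shows "G \<subseteq> standard_binomials"
proof
  fix g assume g: "g \<in> G"
  have G_I: "G \<subseteq> I" and "0 \<notin> G" and init: "initial_ideal r G = initial_ideal r I"
    and lc: "Poly_Mapping.lookup g (lead_mon r g) = 1"
    and red: "\<And>h m. h \<in> G \<Longrightarrow> h \<noteq> g \<Longrightarrow> m \<in> Poly_Mapping.keys g \<Longrightarrow> \<not> mon_dvd (lead_mon r h) m"
    using G g by (auto simp: reduced_groebner_basis_def groebner_basis_def)
  have "g \<noteq> 0" "g \<in> I" using g \<open>0 \<notin> G\<close> G_I by auto
  define u where "u = lead_mon r g"
  have u: "u \<in> Poly_Mapping.keys g" "\<And>m. m \<in> Poly_Mapping.keys g \<Longrightarrow> (m, u) \<in> r"
    using lead_mon_in_keys[OF r \<open>g \<noteq> 0\<close>] lead_mon_max[OF r \<open>g \<noteq> 0\<close>] by (auto simp: u_def)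
  have lead_dvd: "\<exists>h\<in>G. mon_dvd (lead_mon r h) m" if "\<not> standard r m" for m
    using in_initial_ideal_iff[of m] that by (auto simp: init[symmetric] mon_in_initial_ideal_iff)
  have tail: "standard r m" if m: "m \<in> Poly_Mapping.keys g" "m \<noteq> u" for m
  proof (rule ccontr)
    assume "\<not> standard r m"
    then have "mon_dvd u m"
      using lead_dvd red m(1) unfolding u_def by blast
    then show False
      using u(2)[OF m(1)] m(2) monomial_order_dvd[OF r] monomial_order_antisym[OF r] by blast
  qed
  have min: "min_nonstandard r u"
    unfolding min_nonstandard_def
  proof (intro conjI allI impI)
    show "\<not> standard r u"
      unfolding u_def using \<open>g \<in> I\<close> \<open>g \<noteq> 0\<close> by (rule lead_mon_nonstandard)
    fix w assume w: "mon_dvd w u \<and> w \<noteq> u"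
    show "standard r w"
    proof (rule ccontr)
      assume "\<not> standard r w"
      then obtain h where "h \<in> G" "mon_dvd (lead_mon r h) w"
        using lead_dvd by blast
      then show False
        using w red u(1) mon_dvd_trans mon_dvd_antisym unfolding u_def by metis
    qed
  qed
  obtain v where v: "v \<in> Poly_Mapping.keys g" "eqv v u" "v \<noteq> u"
    using no_lonely_term[OF \<open>g \<in> I\<close> u(1)] .
  have only_v: "m = v" if "m \<in> Poly_Mapping.keys g" "eqv m u" "m \<noteq> u" for m
    using that v tail standard_unique[OF r] eqv_trans eqv_sym by metis
  have keys: "Poly_Mapping.keys g \<subseteq> {u, v}"
  proof (rule ccontr)
    assume "\<not> Poly_Mapping.keys g \<subseteq> {u, v}"
    then obtain m where m: "m \<in> Poly_Mapping.keys g" "m \<noteq> u" "m \<noteq> v" by auto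
    obtain m' where m': "m' \<in> Poly_Mapping.keys g" "eqv m' m" "m' \<noteq> m"
      using no_lonely_term[OF \<open>g \<in> I\<close> m(1)] .
    show False
    proof (cases "m' = u")
      case True
      then show False using only_v m m' eqv_sym by blast
    next
      case False
      then show False using tail m m' standard_unique[OF r] by blast
    qed
  qed
  have "{m. m \<in> Poly_Mapping.keys g \<and> eqv m u} = {u, v}"
    using u(1) v keys by auto
  then have "Poly_Mapping.lookup g u + Poly_Mapping.lookup g v = 0"
    using class_sum[OF \<open>g \<in> I\<close>, of u] v(3) by auto
  then have "Poly_Mapping.lookup g v = -1"
    using lc by (simp add: u_def add_eq_0_iff)
  then have "Poly_Mapping.lookup g m = Poly_Mapping.lookup (mon u - mon v) m" for m
    using keys lc v(3) by (auto simp: lookup_minus lookup_mon u_def in_keys_iff)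
  then have "g = mon u - mon v"
    by (rule poly_mapping_eqI)
  then show "g \<in> standard_binomials"
    using min tail[OF v(1,3)] eqv_sym[OF v(2)] unfolding standard_binomials_def by blast
qed

end

lemma universal_groebner_basis_eq_standard_binomials:
  "universal_groebner_basis I = \<Union> {standard_binomials r |r. monomial_order r}"
  unfolding universal_groebner_basis_def
  using reduced_groebner_basis_standard_binomials reduced_groebner_basis_subset by blast

end


section \<open>Primitive binomials and circuits\<close>

context involutive_congruence_ideal
begin

lemma square_binomial: "(var p ^ 2 - 1 :: ('v, 'k) mpoly) = mon (x_mon p + x_mon p) - mon 0"
  by (simp add: var_def power2_eq_square mon_add mon_zero)

text \<open>
  Proper divisors of \<open>u\<close> and all divisors of \<open>v\<close> are standard, which excludes both obstructions:
  a common variable could be cancelled, and a smaller binomial dividing the given one would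
  have two different standard terms in one class.
\<close>
lemma standard_binomial_primitive:
  assumes r: "monomial_order r"
    and u: "min_nonstandard r u" and v: "standard r v" and uv: "eqv u v"
  shows "primitive_binomial I u v"
proof -
  have min: "standard r w" if "mon_dvd w u" "w \<noteq> u" for w
    using u that by (simp add: min_nonstandard_def)
  have "u \<noteq> v"
    using u v by (auto simp: min_nonstandard_def)
  have "Poly_Mapping.keys u \<inter> Poly_Mapping.keys v = {}"
  proof (rule ccontr)
    assume "Poly_Mapping.keys u \<inter> Poly_Mapping.keys v \<noteq> {}"
    then obtain p where "mon_dvd (x_mon p) u" "mon_dvd (x_mon p) v"
      unfolding x_mon_dvd_iff by blast
    then obtain u' v' where u': "u = x_mon p + u'" and v': "v = x_mon p + v'"
      by (auto simp: mon_dvd_iff)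
    have "mon_dvd u' u" "mon_dvd v' v"
      by (auto simp: u' v' mon_dvd_iff add.commute)
    moreover have "u' \<noteq> u"
      using u' by (metis add_cancel_left_left lookup_single_eq lookup_zero zero_neq_one)
    ultimately have "standard r u'" "standard r v'"
      using min v standard_dvd[OF r] by auto
    moreover have "eqv u' v'"
      using uv by (simp add: u' v')
    ultimately show False
      using standard_unique[OF r] u' v' \<open>u \<noteq> v\<close> by blast
  qed
  then have "binomial_pair u v"
    using \<open>u \<noteq> v\<close> by (simp add: binomial_pair_def)
  moreover have "(u', v') = (u, v)"
    if "binomial_pair u' v'" "eqv u' v'" "mon_dvd u' u" "mon_dvd v' v" for u' v'
  proof -
    have v': "standard r v'"
      using v that(4) standard_dvd[OF r] by blast
    have "u' = u"
    proof (rule ccontr)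
      assume "u' \<noteq> u"
      then have "u' = v'"
        using standard_unique[OF r] min that v' by blast
      with that(1) show False by (simp add: binomial_pair_def)
    qed
    moreover from this have "v' = v"
      using standard_unique[OF r v' v] that(2) uv eqv_trans eqv_sym by blast
    ultimately show ?thesis by simp
  qed
  ultimately show ?thesis
    using uv unfolding primitive_binomial_def binomial_in_iff by blast
qed

text \<open>
  Split off a variable \<open>p\<close> of \<open>u\<close>. The cofactor is congruent to \<open>p\<close>, as \<open>p\<close> is its own inverse.
  Both are proper divisors of \<open>u\<close> (\<open>p\<close> itself because no variable is congruent to \<open>1\<close>), hence
  standard; so they coincide.
\<close>
lemma min_nonstandard_eqv_one:
  assumes r: "monomial_order r" and u: "min_nonstandard r u" and "eqv u 0"
  obtains p where "u = x_mon p + x_mon p"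
proof -
  obtain p where "p \<in> Poly_Mapping.keys u"
    using min_nonstandard_neq_zero[OF r u] by fastforce
  then have "mon_dvd (x_mon p) u"
    by (simp only: x_mon_dvd_iff)
  then obtain w where w: "u = x_mon p + w"
    by (auto simp: mon_dvd_iff)
  have "eqv (x_mon p) w"
    using assms(3) unfolding w by (rule eqv_iff_sum[THEN iffD2])
  moreover have "standard r w"
  proof -
    have "mon_dvd w u"
      by (auto simp: w mon_dvd_iff add.commute)
    moreover have "w \<noteq> u"
      using w by (metis add_cancel_left_left lookup_single_eq lookup_zero zero_neq_one)
    ultimately show ?thesis
      using u by (simp add: min_nonstandard_def)
  qed
  moreover have "standard r (x_mon p)"
  proof -
    have "x_mon p \<noteq> u"
      using var_not_eqv_one assms(3) by metis
    then show ?thesis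
      using u \<open>mon_dvd (x_mon p) u\<close> by (simp add: min_nonstandard_def)
  qed
  ultimately have "x_mon p = w"
    using standard_unique[OF r] by blast
  with w that show thesis by blast
qed

text \<open>
  An order that makes \<open>p\<close> the smallest variable leaves only \<open>1\<close> below \<open>p\<close>, so \<open>p\<close> is standard and
  \<open>p\<^sup>2\<close> is minimal nonstandard.
\<close>
lemma square_binomial_in_universal_groebner_basis:
  "(var p ^ 2 - 1 :: ('v, 'k) mpoly) \<in> universal_groebner_basis I"
proof -
  obtain r\<^sub>0 :: "'v monomial rel" where r\<^sub>0: "monomial_order r\<^sub>0"
    using monomial_order_exists by blast
  \<comment> \<open>Any weight that makes \<open>p\<close> strictly lightest will do.\<close>
  define c where "c q = (if q = p then 1 else 2 :: nat)" for q
  define r where "r = weighted_order c r\<^sub>0"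
  have r: "monomial_order r"
    unfolding r_def using r\<^sub>0 by (rule monomial_order_weighted_order)
  have "(x_mon p, x_mon q) \<in> r" for q
    using monomial_order_refl[OF r\<^sub>0]
    by (cases "q = p") (auto simp: r_def weighted_order_def c_def simp flip: One_nat_def)
  then have "(x_mon p, v) \<in> r" if "v \<noteq> 0" for v
    using that monomial_order_trans[OF r] monomial_order_dvd[OF r, of "x_mon _" v]
    unfolding x_mon_dvd_iff by (metis all_not_in_conv keys_eq_empty)
  then have std: "standard r (x_mon p)"
    using var_not_eqv_one unfolding standard_def by metis
  have "min_nonstandard r (x_mon p + x_mon p)"
    unfolding min_nonstandard_def
  proof (intro conjI allI impI)
    show "\<not> standard r (x_mon p + x_mon p)"
      by (rule not_standard_square[OF r])
    fix w assume w: "mon_dvd w (x_mon p + x_mon p) \<and> w \<noteq> x_mon p + x_mon p"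
    have le: "expo_at w q \<le> (if q = p then 2 else 0)" for q
      using w by (auto simp: mon_dvd_def lookup_add lookup_single when_def split: if_splits
          dest!: spec[of _ q])
    have "expo_at w p \<noteq> 2"
    proof
      assume "expo_at w p = 2"
      then have "expo_at w q = expo_at (x_mon p + x_mon p) q" for q
        using le[of q] by (auto simp: lookup_add lookup_single when_def split: if_splits)
      then have "w = x_mon p + x_mon p"
        by (rule poly_mapping_eqI)
      with w show False by simp
    qed
    then have "expo_at w q \<le> expo_at (x_mon p) q" for q
      using le[of q] by (auto simp: lookup_single when_def split: if_splits)
    then have "mon_dvd w (x_mon p)"
      by (simp add: mon_dvd_def)
    then show "standard r w"
      using std standard_dvd[OF r] by blast
  qed
  then have "(var p ^ 2 - 1 :: ('v, 'k) mpoly) \<in> standard_binomials r"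
    unfolding square_binomial standard_binomials_def[OF r]
    using standard_zero[OF r] eqv_double by blast
  then show ?thesis
    using r by (auto simp: universal_groebner_basis_eq_standard_binomials)
qed

text \<open>
  A repeated variable on one side would give the smaller binomial \<open>p\<^sup>2 - 1\<close> or \<open>1 - p\<^sup>2\<close>. A set \<open>S\<close> with
  product congruent to \<open>1\<close> gives the smaller binomial with terms \<open>S \<inter> U\<close> and \<open>S \<inter> V\<close>.
\<close>
lemma primitive_binomial_circuit:
  assumes prim: "primitive_binomial I u v" and "u \<noteq> 0" "v \<noteq> 0"
  obtains U V where "u = sqfree U" "v = sqfree V" "U \<inter> V = {}"
    "\<And>S. S \<subseteq> U \<union> V \<Longrightarrow> eqv (sqfree S) 0 \<Longrightarrow> S = {} \<or> S = U \<union> V"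
proof -
  have pair: "binomial_pair u v"
    and prim': "\<And>u' v'. binomial_pair u' v' \<Longrightarrow> eqv u' v' \<Longrightarrow> mon_dvd u' u \<Longrightarrow> mon_dvd v' v \<Longrightarrow>
      u' = u \<and> v' = v"
    using prim unfolding primitive_binomial_def binomial_in_iff by blast+
  have sq_neq_zero: "x_mon p + x_mon p \<noteq> 0" for p
    by (metis add_eq_0_iff_both_eq_0 lookup_single_eq lookup_zero zero_neq_one lookup_add)
  have sq_dvd: "mon_dvd (x_mon p + x_mon p) w" if "\<not> expo_at w p \<le> 1" for w p
    using that by (auto simp: mon_dvd_def lookup_add lookup_single when_def)
  have zero_dvd: "mon_dvd 0 w" for w :: "'v monomial"
    by (simp add: mon_dvd_def)
  define U V where "U = Poly_Mapping.keys u" and "V = Poly_Mapping.keys v"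
  have "expo_at u p \<le> 1" for p
    using prim'[of "x_mon p + x_mon p" 0] \<open>v \<noteq> 0\<close> sq_dvd zero_dvd eqv_double sq_neq_zero
    by (fastforce simp: binomial_pair_def)
  then have u: "u = sqfree U"
    unfolding U_def by (rule eq_sqfree_keys)
  have "expo_at v p \<le> 1" for p
    using prim'[of 0 "x_mon p + x_mon p"] \<open>u \<noteq> 0\<close> sq_dvd zero_dvd eqv_sym[OF eqv_double]
      sq_neq_zero[symmetric]
    by (fastforce simp: binomial_pair_def)
  then have v: "v = sqfree V"
    unfolding V_def by (rule eq_sqfree_keys)
  have disj: "U \<inter> V = {}"
    using pair by (simp add: binomial_pair_def U_def V_def)
  have circuit: "S = {} \<or> S = U \<union> V" if S: "S \<subseteq> U \<union> V" "eqv (sqfree S) 0" for S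
  proof (cases "S = {}")
    case False
    have "sym_diff (S \<inter> U) (S \<inter> V) = S"
      using S(1) disj by auto
    then have "eqv (sqfree (S \<inter> U)) (sqfree (S \<inter> V))"
      using S(2) by (simp add: eqv_sqfree_iff)
    moreover have "binomial_pair (sqfree (S \<inter> U)) (sqfree (S \<inter> V))"
      using False S(1) disj by (auto simp: binomial_pair_def)
    moreover have "mon_dvd (sqfree (S \<inter> U)) u" "mon_dvd (sqfree (S \<inter> V)) v"
      by (simp_all add: u v)
    ultimately have "sqfree (S \<inter> U) = u \<and> sqfree (S \<inter> V) = v"
      using prim' by blast
    then have "S \<inter> U = U" "S \<inter> V = V"
      by (simp_all add: u v)
    with S(1) show ?thesis by blast
  qed simp
  show thesis
    using that[OF u v disj circuit] .
qed

text \<open>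
  The weights balance the two sides, \<open>w(U) = w(V) = |U| |V|\<close>, and keep all other variables out of
  the comparison. A squarefree monomial in the class of \<open>S \<subset> U\<close> over these variables is \<open>S\<close> itself or
  the complement \<open>(U - S) \<union> V\<close>, whose weight exceeds \<open>w(V) \<ge> w(S)\<close>. For \<open>V\<close> the only competitor is
  \<open>U\<close>, and the degree in the variables of \<open>U\<close> decides.
\<close>
lemma circuit_binomial_in_universal_groebner_basis:
  assumes disj: "U \<inter> V = {}" and ne: "U \<noteq> {}" "V \<noteq> {}"
    and eqv_UV: "eqv (sqfree U) (sqfree V)"
    and circuit: "\<And>S. S \<subseteq> U \<union> V \<Longrightarrow> eqv (sqfree S) 0 \<Longrightarrow> S = {} \<or> S = U \<union> V"
  shows "mon (sqfree U) - mon (sqfree V) \<in> universal_groebner_basis I"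
proof -
  obtain r\<^sub>0 :: "'v monomial rel" where r\<^sub>0: "monomial_order r\<^sub>0"
    using monomial_order_exists by blast
  define r\<^sub>1 where "r\<^sub>1 = weighted_order (\<lambda>p. if p \<in> U then 1 else 0) r\<^sub>0"
  define c where
    "c p = (if p \<in> U then card V else if p \<in> V then card U else card U * card V + 1)" for p
  define r where "r = weighted_order c r\<^sub>1"
  have r: "monomial_order r"
    unfolding r_def r\<^sub>1_def using r\<^sub>0 by (intro monomial_order_weighted_order)
  have pos: "card U > 0" "card V > 0"
    using ne by (simp_all add: card_gt_0_iff)
  have wU: "sum c S = card V * card S" if "S \<subseteq> U" for S
  proof -
    have "sum c S = (\<Sum>p\<in>S. card V)"
      using that by (intro sum.cong) (auto simp: c_def)
    then show ?thesis by simp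
  qed
  have wV: "sum c V = card U * card V"
  proof -
    have "sum c V = (\<Sum>p\<in>V. card U)"
      using disj by (intro sum.cong) (auto simp: c_def)
    then show ?thesis by simp
  qed
  have wU_le: "sum c S \<le> card U * card V" if "S \<subseteq> U" for S
    using card_mono[OF finite that] by (simp add: wU[OF that] mult.commute)
  have outside: "(sqfree S, sqfree T) \<in> r"
    if S: "sum c S \<le> card U * card V" and T: "\<not> T \<subseteq> U \<union> V" for S T
  proof -
    obtain p where p: "p \<in> T" "p \<notin> U \<union> V" using T by blast
    have "card U * card V < c p"
      using p by (simp add: c_def)
    also have "c p \<le> sum c T"
      using p by (intro member_le_sum) auto
    finally show ?thesis
      using S by (auto simp: r_def weighted_order_def weight_sqfree)
  qed
  have inside: "T = S \<or> T = (U \<union> V) - S"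
    if "eqv (sqfree S) (sqfree T)" "S \<subseteq> U \<union> V" "T \<subseteq> U \<union> V" for S T
  proof -
    have "sym_diff S T = {} \<or> sym_diff S T = U \<union> V"
      using that by (intro circuit) (auto simp: eqv_sqfree_iff)
    then show ?thesis using that(2,3) by blast
  qed
  have VU: "(sqfree V, sqfree U) \<in> r"
  proof -
    have "(\<Sum>p\<in>V. if p \<in> U then 1 else 0 :: nat) = 0"
      using disj by (intro sum.neutral) auto
    moreover have "(\<Sum>p\<in>U. if p \<in> U then 1 else 0 :: nat) = card U"
      by simp
    ultimately have "(sqfree V, sqfree U) \<in> r\<^sub>1"
      using pos by (auto simp: r\<^sub>1_def weighted_order_def weight_sqfree)
    then show ?thesis
      using wU[of U] wV by (simp add: r_def weighted_order_def weight_sqfree mult.commute)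
  qed
  have V: "standard r (sqfree V)"
  proof (rule standardI_sqfree[OF r])
    fix T assume T: "eqv (sqfree V) (sqfree T)"
    show "(sqfree V, sqfree T) \<in> r"
    proof (cases "T \<subseteq> U \<union> V")
      case True
      then have "T = V \<or> T = U"
        using inside[OF T] disj by blast
      then show ?thesis
        using VU monomial_order_refl[OF r] by auto
    qed (simp add: outside wV)
  qed
  have proper: "standard r (sqfree S)" if S: "S \<subset> U" for S
  proof (rule standardI_sqfree[OF r])
    fix T assume T: "eqv (sqfree S) (sqfree T)"
    show "(sqfree S, sqfree T) \<in> r"
    proof (cases "T \<subseteq> U \<union> V")
      case True
      then consider "T = S" | "T = (U - S) \<union> V"
        using inside[OF T] S disj by blast
      then show ?thesis
      proof cases
        case 2
        have "sum c T = sum c (U - S) + sum c V"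
          unfolding 2 using disj by (intro sum.union_disjoint) auto
        moreover have "sum c (U - S) > 0"
          using S pos by (auto simp: wU card_gt_0_iff)
        moreover have "sum c S \<le> sum c V"
          using wU_le[of S] S wV by simp
        ultimately show ?thesis
          by (simp add: r_def weighted_order_def weight_sqfree)
      qed (simp add: monomial_order_refl[OF r])
    next
      case False
      then show ?thesis using outside wU_le S by blast
    qed
  qed
  have "sqfree U \<noteq> sqfree V"
    using disj ne by auto
  then have "\<not> standard r (sqfree U)"
    using V eqv_UV standard_unique[OF r] by blast
  then have "min_nonstandard r (sqfree U)"
    unfolding min_nonstandard_def using proper by (metis dvd_sqfreeE psubsetI)
  then have "mon (sqfree U) - mon (sqfree V) \<in> standard_binomials r"
    unfolding standard_binomials_def[OF r] using V eqv_UV by blast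
  then show ?thesis
    using r by (auto simp: universal_groebner_basis_eq_standard_binomials)
qed

theorem universal_groebner_basis_eq:
  "universal_groebner_basis I =
    {mon u - mon v |u v. primitive_binomial I u v \<and>
       ((mon u \<noteq> (1 :: ('v, 'k) mpoly) \<and> mon v \<noteq> (1 :: ('v, 'k) mpoly)) \<or>
        (\<exists>p. mon u - mon v = (var p ^ 2 - 1 :: ('v, 'k) mpoly)))}" (is "_ = ?B")
proof
  show "universal_groebner_basis I \<subseteq> ?B"
  proof
    fix g assume "g \<in> universal_groebner_basis I"
    then obtain r where r: "monomial_order r" and "g \<in> standard_binomials r"
      by (auto simp: universal_groebner_basis_eq_standard_binomials)
    then obtain u v where g: "g = mon u - mon v"
      and uv: "min_nonstandard r u" "standard r v" "eqv u v"
      by (auto simp: standard_binomials_def)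
    have "primitive_binomial I u v"
      using standard_binomial_primitive[OF r uv] .
    moreover have "u \<noteq> 0"
      using min_nonstandard_neq_zero[OF r uv(1)] .
    moreover have "\<exists>p. mon u - mon v = (var p ^ 2 - 1 :: ('v, 'k) mpoly)" if v: "v = 0"
    proof -
      obtain p where "u = x_mon p + x_mon p"
        using min_nonstandard_eqv_one[OF r uv(1)] uv(3) v by blast
      with v show ?thesis
        using square_binomial by metis
    qed
    ultimately show "g \<in> ?B"
      using g by auto
  qed
next
  show "?B \<subseteq> universal_groebner_basis I"
  proof clarify
    fix u v
    assume prim: "primitive_binomial I u v"
      and "(mon u \<noteq> (1 :: ('v, 'k) mpoly) \<and> mon v \<noteq> (1 :: ('v, 'k) mpoly)) \<or>
        (\<exists>p. mon u - mon v = (var p ^ 2 - 1 :: ('v, 'k) mpoly))"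
    then consider "u \<noteq> 0" "v \<noteq> 0" | p where "mon u - mon v = (var p ^ 2 - 1 :: ('v, 'k) mpoly)"
      by auto
    then show "mon u - mon v \<in> universal_groebner_basis I"
    proof cases
      case 1
      then obtain U V where UV: "u = sqfree U" "v = sqfree V" "U \<inter> V = {}"
        "\<And>S. S \<subseteq> U \<union> V \<Longrightarrow> eqv (sqfree S) 0 \<Longrightarrow> S = {} \<or> S = U \<union> V"
        using primitive_binomial_circuit[OF prim] by blast
      moreover have "eqv u v"
        using prim by (simp add: primitive_binomial_def binomial_in_iff)
      moreover have "U \<noteq> {}" "V \<noteq> {}"
        using 1 UV(1,2) by auto
      ultimately show ?thesis
        using circuit_binomial_in_universal_groebner_basis[of U V] by simp
    next
      case 2
      then show ?thesis
        using square_binomial_in_universal_groebner_basis by simp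
    qed
  qed
qed

end


section \<open>The generalized code ideal\<close>

text \<open>
  Multiplication by \<open>x\<close> permutes the nonzero elements, so their product is multiplied by \<open>1\<close> on the
  one hand and by the power on the other.
\<close>
lemma finite_field_power_card_minus_one:
  fixes x :: "'f::{finite,field}"
  assumes "x \<noteq> 0"
  shows "x ^ (CARD('f) - 1) = 1"
proof -
  have "(\<Prod>y\<in>UNIV - {0}. y) = (\<Prod>y\<in>UNIV - {0}. x * y)"
    by (rule prod.reindex_bij_witness[of _ "\<lambda>y. x * y" "\<lambda>y. y / x"]) (use assms in auto)
  also have "\<dots> = x ^ (CARD('f) - 1) * (\<Prod>y\<in>UNIV - {0}. y)"
    by (simp add: prod.distrib card_Diff_subset)
  finally show ?thesis
    by simp
qed

text \<open>
  The exponents \<open>1, \<dots>, q - 1\<close> already give all powers, because \<open>\<alpha>\<^bsup>q-1\<^esup> = 1\<close>; surjectivity onto as many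
  nonzero elements implies injectivity.
\<close>
lemma
  fixes \<alpha> :: "'f::{finite,field}"
  assumes "primitive_element \<alpha>"
  shows pw_nonzero: "pw \<alpha> j \<noteq> 0"
    and pw_inj_iff: "pw \<alpha> j = pw \<alpha> k \<longleftrightarrow> j = k"
    and ex_pw: "x \<noteq> 0 \<Longrightarrow> \<exists>j. x = pw \<alpha> j"
proof -
  have powers: "range (\<lambda>k::nat. \<alpha> ^ k) = UNIV - {0}"
    using assms by (simp add: primitive_element_def)
  then have "\<alpha> \<noteq> 0"
    by (metis DiffD2 power_one_right rangeI singletonI)
  then show nz: "pw \<alpha> j \<noteq> 0" for j
    by (simp add: pw_def)
  define m where "m = CARD('f) - 1"
  have expo: "type_definition (Rep_expo :: 'f expo \<Rightarrow> nat) Abs_expo {1..m}"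
    using type_definition_expo[where 'f = 'f] by (simp add: m_def)
  have "card {0, 1 :: 'f} \<le> CARD('f)"
    by (rule card_mono) auto
  then have "m > 0"
    by (simp add: m_def)
  have "\<alpha> ^ m = 1"
    unfolding m_def using \<open>\<alpha> \<noteq> 0\<close> by (rule finite_field_power_card_minus_one)
  have surj: "\<exists>j. x = pw \<alpha> j" if x: "x \<noteq> 0" for x
  proof -
    obtain k where k: "x = \<alpha> ^ k"
      using powers x by blast
    \<comment> \<open>The residue \<open>0\<close> is represented by \<open>m\<close>, since the exponents start at \<open>1\<close>.\<close>
    define l where "l = (if k mod m = 0 then m else k mod m)"
    have "\<alpha> ^ k = \<alpha> ^ (m * (k div m) + k mod m)"
      by simp
    also have "\<dots> = \<alpha> ^ (k mod m)"
      unfolding power_add power_mult \<open>\<alpha> ^ m = 1\<close> by simp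
    also have "\<dots> = \<alpha> ^ l"
      using \<open>\<alpha> ^ m = 1\<close> by (simp add: l_def)
    finally have "x = \<alpha> ^ l"
      using k by simp
    moreover have "l \<in> {1..m}"
      using \<open>m > 0\<close> mod_less_divisor[of m k] by (auto simp: l_def)
    then have "Rep_expo (Abs_expo l :: 'f expo) = l"
      by (rule type_definition.Abs_inverse[OF expo])
    ultimately show ?thesis
      by (auto simp: pw_def intro!: exI[of _ "Abs_expo l"])
  qed
  then show "x \<noteq> 0 \<Longrightarrow> \<exists>j. x = pw \<alpha> j" .
  have "range (pw \<alpha>) = UNIV - {0}"
    using nz surj by auto
  moreover have "CARD('f expo) = m"
    using type_definition.card[OF expo] by simp
  ultimately have "inj (pw \<alpha>)"
    by (intro eq_card_imp_inj_on) (simp_all add: m_def card_Diff_subset)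
  then show "pw \<alpha> j = pw \<alpha> k \<longleftrightarrow> j = k"
    by (rule inj_eq)
qed

text \<open>
  The homomorphism of which the crossing map is a section: \<open>x\<^sub>i\<^sub>j\<close> goes to the vector with \<open>\<alpha>\<^sup>j\<close> in position
  \<open>i\<close>.
\<close>
definition evaluate :: "'f::{finite,field} \<Rightarrow> ('n::finite \<times> 'f expo) monomial \<Rightarrow> 'f ^ 'n" where
  "evaluate \<alpha> u = (\<chi> i. \<Sum>j\<in>UNIV. of_nat (expo_at u (i, j)) * pw \<alpha> j)"

lemma evaluate_zero [simp]: "evaluate \<alpha> 0 = 0"
  by (simp add: evaluate_def vec_eq_iff)

lemma evaluate_add: "evaluate \<alpha> (u + v) = evaluate \<alpha> u + evaluate \<alpha> v"
  by (simp add: evaluate_def vec_eq_iff lookup_add sum.distrib algebra_simps)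

lemma evaluate_sum: "evaluate \<alpha> (sum f A) = (\<Sum>a\<in>A. evaluate \<alpha> (f a))"
  by (induction A rule: infinite_finite_induct) (simp_all add: evaluate_add)

lemma evaluate_x_mon: "evaluate \<alpha> (x_mon (i, j)) = axis i (pw \<alpha> j)"
proof -
  have "(\<Sum>j'\<in>UNIV. of_nat (expo_at (x_mon (i, j)) (i', j')) * pw \<alpha> j') =
      (\<Sum>j'\<in>UNIV. if j' = j then (if i' = i then pw \<alpha> j else 0) else 0)" for i'
    by (intro sum.cong) (auto simp: lookup_single when_def)
  then show ?thesis
    by (simp add: evaluate_def vec_eq_iff axis_def)
qed

lemma
  shows field_ideal_add: "f \<in> field_ideal \<alpha> \<Longrightarrow> g \<in> field_ideal \<alpha> \<Longrightarrow> f + g \<in> field_ideal \<alpha>"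
    and field_ideal_diff: "f \<in> field_ideal \<alpha> \<Longrightarrow> g \<in> field_ideal \<alpha> \<Longrightarrow> f - g \<in> field_ideal \<alpha>"
    and field_ideal_scale: "f \<in> field_ideal \<alpha> \<Longrightarrow> h * f \<in> field_ideal \<alpha>"
  unfolding field_ideal_def by (simp_all add: ideal.span_add ideal.span_diff ideal.span_scale)

lemma field_ideal_sum:
  assumes "pw \<alpha> u + pw \<alpha> v = pw \<alpha> w"
  shows "var (i, u) * var (i, v) - var (i, w) \<in> field_ideal \<alpha>"
  unfolding field_ideal_def using assms
  by (intro ideal.span_base UN_I[of i] UnI1 CollectI exI conjI refl) simp_all

lemma field_ideal_inverse:
  assumes "pw \<alpha> u + pw \<alpha> v = 0"
  shows "var (i, u) * var (i, v) - 1 \<in> field_ideal \<alpha>"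
  unfolding field_ideal_def using assms
  by (intro ideal.span_base UN_I[of i] UnI2 CollectI exI conjI refl) simp_all

definition crossing_block :: "'f::{finite,field} \<Rightarrow> 'n::finite \<Rightarrow> 'f \<Rightarrow> ('n \<times> 'f expo) monomial" where
  "crossing_block \<alpha> i x = (\<Sum>j\<in>{j. x = pw \<alpha> j}. x_mon (i, j))"

lemma crossing_eq_sum_blocks: "crossing \<alpha> a = (\<Sum>i\<in>UNIV. crossing_block \<alpha> i (a $ i))"
  by (simp add: crossing_def crossing_block_def)

context
  fixes \<alpha> :: "'f::{finite,field}"
  assumes alpha: "primitive_element \<alpha>"
begin

lemma crossing_block_zero: "crossing_block \<alpha> i 0 = 0"
  by (simp add: crossing_block_def pw_nonzero[OF alpha, symmetric])

lemma crossing_block_pw: "crossing_block \<alpha> i (pw \<alpha> j) = x_mon (i, j)"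
  by (simp add: crossing_block_def pw_inj_iff[OF alpha])

lemma evaluate_crossing_block: "evaluate \<alpha> (crossing_block \<alpha> i x) = axis i x"
proof (cases "x = 0")
  case True
  then show ?thesis by (simp add: crossing_block_zero axis_def vec_eq_iff)
next
  case False
  then obtain j where "x = pw \<alpha> j" using ex_pw[OF alpha] by blast
  then show ?thesis by (simp only: crossing_block_pw evaluate_x_mon)
qed

lemma evaluate_crossing: "evaluate \<alpha> (crossing \<alpha> a) = a"
  by (simp add: crossing_eq_sum_blocks evaluate_sum evaluate_crossing_block vec_eq_iff axis_def
      if_distrib cong: if_cong)

text \<open>
  Within one block, the relations of the field ideal are the addition table of the field.
\<close>
lemma crossing_block_add_in_field_ideal:
  "mon (crossing_block \<alpha> i x + x_mon (i, j)) - mon (crossing_block \<alpha> i (x + pw \<alpha> j))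
    \<in> (field_ideal \<alpha> :: ('n::finite \<times> 'f expo, 'k::field) mpoly set)"
proof (cases "x = 0")
  case True
  then show ?thesis
    by (simp only: crossing_block_zero crossing_block_pw add_0 diff_self)
      (simp add: field_ideal_def ideal.span_zero)
next
  case False
  then obtain k where k: "x = pw \<alpha> k" using ex_pw[OF alpha] by blast
  have prod: "mon (crossing_block \<alpha> i x + x_mon (i, j)) =
      (var (i, k) * var (i, j) :: ('n \<times> 'f expo, 'k) mpoly)"
    by (simp only: k crossing_block_pw mon_add var_def)
  show ?thesis
  proof (cases "x + pw \<alpha> j = 0")
    case True
    show ?thesis
      unfolding prod True crossing_block_zero mon_zero
      using True by (intro field_ideal_inverse) (simp add: k)
  next
    case False
    then obtain l where l: "x + pw \<alpha> j = pw \<alpha> l" using ex_pw[OF alpha] by blast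
    then show ?thesis
      unfolding prod l crossing_block_pw var_def[symmetric]
      using l by (intro field_ideal_sum) (simp add: k)
  qed
qed

lemma crossing_add_in_field_ideal:
  "mon (crossing \<alpha> a + x_mon (i, j)) - mon (crossing \<alpha> (a + axis i (pw \<alpha> j)))
    \<in> (field_ideal \<alpha> :: ('n::finite \<times> 'f expo, 'k::field) mpoly set)"
proof -
  define rest where "rest = (\<Sum>i'\<in>UNIV - {i}. crossing_block \<alpha> i' (a $ i'))"
  have a: "crossing \<alpha> a = rest + crossing_block \<alpha> i (a $ i)"
    by (simp add: crossing_eq_sum_blocks rest_def sum.remove[of UNIV i] add.commute)
  have "crossing \<alpha> (a + axis i (pw \<alpha> j)) =
      (\<Sum>i'\<in>UNIV - {i}. crossing_block \<alpha> i' ((a + axis i (pw \<alpha> j)) $ i')) +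
      crossing_block \<alpha> i (a $ i + pw \<alpha> j)"
    by (simp add: crossing_eq_sum_blocks sum.remove[of UNIV i] add.commute axis_def)
  also have "(\<Sum>i'\<in>UNIV - {i}. crossing_block \<alpha> i' ((a + axis i (pw \<alpha> j)) $ i')) = rest"
    unfolding rest_def by (intro sum.cong) (auto simp: axis_def)
  finally have "mon (crossing \<alpha> a + x_mon (i, j)) - mon (crossing \<alpha> (a + axis i (pw \<alpha> j))) =
      (mon rest * (mon (crossing_block \<alpha> i (a $ i) + x_mon (i, j)) -
        mon (crossing_block \<alpha> i (a $ i + pw \<alpha> j))) :: ('n \<times> 'f expo, 'k) mpoly)"
    unfolding a by (simp only: mon_add right_diff_distrib mult.assoc)
  then show ?thesis
    by (simp only: field_ideal_scale crossing_block_add_in_field_ideal)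
qed

text \<open>
  Multiplying up \<open>u\<close> variable by variable, each new variable is absorbed into the crossing by one
  entry of the addition table.
\<close>
lemma monomial_minus_crossing_in_field_ideal:
  "mon u - mon (crossing \<alpha> (evaluate \<alpha> u))
    \<in> (field_ideal \<alpha> :: ('n::finite \<times> 'f expo, 'k::field) mpoly set)"
proof (induction u rule: monomial_induct)
  case zero
  have "crossing \<alpha> 0 = (0 :: ('n \<times> 'f expo) monomial)"
    by (simp add: crossing_eq_sum_blocks crossing_block_zero)
  then show ?case by (simp add: field_ideal_def ideal.span_zero)
next
  case (mult u p)
  obtain i j where p: "p = (i, j)" by (cases p)
  let ?c = "crossing \<alpha> (evaluate \<alpha> u)"
  have "mon (u + x_mon p) - mon (crossing \<alpha> (evaluate \<alpha> (u + x_mon p))) =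
      (mon (x_mon p) * (mon u - mon ?c) + (mon (?c + x_mon (i, j)) -
        mon (crossing \<alpha> (evaluate \<alpha> u + axis i (pw \<alpha> j)))) :: ('n \<times> 'f expo, 'k) mpoly)"
    unfolding p evaluate_add evaluate_x_mon by (simp only: mon_add right_diff_distrib) (simp add: algebra_simps)
  then show ?case
    using mult by (simp only: field_ideal_add field_ideal_scale crossing_add_in_field_ideal)
qed

end

lemma code_ideal_eq_span:
  "code_ideal \<alpha> C = ideal.span
    ({mon (crossing \<alpha> a) - mon (crossing \<alpha> b) |a b. a - b \<in> C} \<union>
     (\<Union>i. {var (i, u) * var (i, v) - var (i, w) |u v w. pw \<alpha> u + pw \<alpha> v = pw \<alpha> w} \<union>
       {var (i, u) * var (i, v) - 1 |u v. pw \<alpha> u + pw \<alpha> v = 0}))"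
  unfolding code_ideal_def field_ideal_def ideal.span_Un[symmetric] ..

lemma hamming_weight_axis: "x \<noteq> 0 \<Longrightarrow> hamming_weight (axis i x) = 1"
  by (simp add: hamming_weight_def axis_def)

text \<open>
  Pass from \<open>u\<close> to the crossing of its value, from there to the crossing of the value of \<open>v\<close> by a
  generator that comes from the code, and back to \<open>v\<close>.
\<close>
lemma binomial_in_code_ideal:
  assumes "primitive_element \<alpha>" "evaluate \<alpha> u - evaluate \<alpha> v \<in> C"
  shows "(mon u - mon v :: ('n::finite \<times> 'f::{finite,field} expo, 'k::field) mpoly) \<in> code_ideal \<alpha> C"
proof -
  let ?c = "\<lambda>u. mon (crossing \<alpha> (evaluate \<alpha> u)) :: ('n \<times> 'f expo, 'k) mpoly"
  have "?c u - ?c v \<in> ideal.span {mon (crossing \<alpha> a) - mon (crossing \<alpha> b) |a b. a - b \<in> C}"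
    using assms(2) by (intro ideal.span_base) blast
  moreover have "(mon u - ?c u) - (mon v - ?c v) \<in> field_ideal \<alpha>"
    by (intro field_ideal_diff monomial_minus_crossing_in_field_ideal assms(1))
  moreover have "mon u - mon v = (?c u - ?c v) + ((mon u - ?c u) - (mon v - ?c v))"
    by simp
  ultimately show ?thesis
    unfolding code_ideal_def by blast
qed

lemma code_ideal_generator:
  assumes "primitive_element \<alpha>" and "vec.subspace C"
    and "g \<in> {mon (crossing \<alpha> a) - mon (crossing \<alpha> b) |a b. a - b \<in> C} \<union>
     (\<Union>i. {var (i, u) * var (i, v) - var (i, w) |u v w. pw \<alpha> u + pw \<alpha> v = pw \<alpha> w} \<union>
       {var (i, u) * var (i, v) - 1 |u v. pw \<alpha> u + pw \<alpha> v = 0})"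
  shows "\<exists>a b. g = (mon a - mon b :: ('n::finite \<times> 'f::{finite,field} expo, 'k::field) mpoly) \<and>
    evaluate \<alpha> a - evaluate \<alpha> b \<in> C"
proof -
  have axis_add: "axis i x + axis i y = axis i (x + y)" for i :: 'n and x y :: 'f
    by (simp add: vec_eq_iff axis_def)
  have axis_zero: "axis i 0 = (0 :: 'f ^ 'n)" for i
    by (simp add: vec_eq_iff axis_def)
  have C0: "0 \<in> C"
    using assms(2) by (rule vec.subspace_0)
  consider (code) a b where "g = mon (crossing \<alpha> a) - mon (crossing \<alpha> b)" "a - b \<in> C"
    | (sum) i u v w where "g = var (i, u) * var (i, v) - var (i, w)" "pw \<alpha> u + pw \<alpha> v = pw \<alpha> w"
    | (inverse) i u v where "g = var (i, u) * var (i, v) - 1" "pw \<alpha> u + pw \<alpha> v = 0"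
    using assms(3) by (elim UnE UN_E CollectE exE conjE) (rule that; assumption)+
  then show ?thesis
  proof cases
    case code
    then show ?thesis
      using evaluate_crossing[OF assms(1)] by metis
  next
    case sum
    then have "g = mon (x_mon (i, u) + x_mon (i, v)) - mon (x_mon (i, w))"
      by (simp only: mon_add var_def)
    moreover have "evaluate \<alpha> (x_mon (i, u) + x_mon (i, v)) - evaluate \<alpha> (x_mon (i, w)) = 0"
      by (simp only: evaluate_add evaluate_x_mon axis_add sum(2) diff_self)
    ultimately show ?thesis using C0 by metis
  next
    case inverse
    then have "g = mon (x_mon (i, u) + x_mon (i, v)) - mon 0"
      by (simp only: mon_add mon_zero var_def)
    moreover have "evaluate \<alpha> (x_mon (i, u) + x_mon (i, v)) - evaluate \<alpha> 0 = 0"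
      by (simp only: evaluate_add evaluate_x_mon axis_add inverse(2) axis_zero evaluate_zero diff_self)
    ultimately show ?thesis using C0 by metis
  qed
qed

theorem proposition5p3:
  fixes \<alpha> :: "'f::{finite,field}"
    and C :: "('f ^ 'n::finite) set"
    and I :: "('n \<times> 'f expo, 'k::field) mpoly set"
  assumes char_two: "CHAR('f) = 2"
    and alpha: "primitive_element \<alpha>"
    and code: "vec.subspace C"
    and no_weight_one: "\<forall>c\<in>C. hamming_weight c \<noteq> 1"
    and I: "I = code_ideal \<alpha> C"
  shows "universal_groebner_basis I =
    {mon u - mon v |u v. primitive_binomial I u v \<and>
       ((mon u \<noteq> (1 :: ('n \<times> 'f expo, 'k) mpoly) \<and> mon v \<noteq> (1 :: ('n \<times> 'f expo, 'k) mpoly)) \<or>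
        (\<exists>i j. mon u - mon v = (var (i, j) ^ 2 - 1 :: ('n \<times> 'f expo, 'k) mpoly)))}"
proof -
  define eqv :: "('n \<times> 'f expo) monomial \<Rightarrow> ('n \<times> 'f expo) monomial \<Rightarrow> bool"
    where "eqv u v \<longleftrightarrow> evaluate \<alpha> u - evaluate \<alpha> v \<in> C" for u v
  interpret involutive_congruence eqv
  proof
    show "equivp eqv"
    proof (rule equivpI)
      show "reflp eqv"
        using vec.subspace_0[OF code] by (simp add: reflp_def eqv_def)
      show "symp eqv"
        using vec.subspace_neg[OF code] by (fastforce simp: symp_def eqv_def)
      show "transp eqv"
        using vec.subspace_add[OF code] by (fastforce simp: transp_def eqv_def)
    qed
    have "x + x = 0" for x :: 'f
      using of_nat_CHAR[where 'a = 'f] by (simp add: char_two flip: mult_2)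
    then have "a + a = 0" for a :: "'f ^ 'n"
      by (simp add: vec_eq_iff)
    then show "eqv (u + u) 0" for u
      using vec.subspace_0[OF code] by (simp add: eqv_def evaluate_add)
  qed (simp add: eqv_def evaluate_add)
  interpret involutive_congruence_ideal eqv I
  proof
    show "\<not> eqv (x_mon p) 0" for p
      using no_weight_one hamming_weight_axis[OF pw_nonzero[OF alpha]]
      by (cases p) (auto simp: eqv_def evaluate_x_mon simp del: One_nat_def)
    show "mon u - mon v \<in> I" if "eqv u v" for u v
      using that binomial_in_code_ideal[OF alpha] by (simp add: eqv_def I)
    show "(\<Sum>m | m \<in> Poly_Mapping.keys f \<and> eqv m u. Poly_Mapping.lookup f m) = 0" if "f \<in> I" for f u
      using that coeff_sum_span[OF code_ideal_generator[OF alpha code, folded eqv_def]]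
      unfolding I code_ideal_eq_span coeff_sum_def by blast
  qed
  show ?thesis
    using universal_groebner_basis_eq by simp
qed

end
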